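(* Let $f:\mathbb{R}\to\mathbb{R}$ be a normalized stationary centered Gaussian process of class $\mathcal{C}^1$. Let $R>0$ and let $\nu_R$ denote the counting measure of $\{x \in \mathbb{R} \mid f(Rx)=0\}$. Let $\phi:\mathbb{R}\to\mathbb{R}$ be a Borel-measurable function. If $\phi$ is non-negative or Lebesgue-integrable, then $$\mathbb{E}[\langle\nu_R,\phi\rangle] = \frac{R}{\pi}\int_{-\infty}^{+\infty}\phi(x)\,dx.$$ In particular, as Radon measures, $\mathbb{E}[\nu_R]=\frac{R}{\pi}\,dx$, where $dx$ is the Lebesgue measure of $\mathbb{R}$.
   Context: A process is of class $\mathcal{C}^1$ if its trajectories are almost surely $\mathcal{C}^1$. The correlation function of $f$ is $\kappa(x)=\mathbb{E}[f(0)f(x)]$; $f$ is normalized if $\kappa(0)=1=-\kappa''(0)$. The zero set of $f$ is almost surely closed and discrete; $\nu_R=\sum_{x: f(Rx)=0}\delta_x$ and $\langle\nu_R,\phi\rangle=\sum_{x: f(Rx)=0}\phi(x)$ (in $[0,+\infty]$ if $\phi\ge0$; almost surely absolutely convergent if $\phi$ is integrable). $\mathbb{E}[\nu_R]$ is the Radon measure defined by $\langle \mathbb{E}[\nu_R],\phi\rangle=\mathbb{E}[\langle\nu_R,\phi\rangle]$ for all continuous compactly supported $\phi$. *)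

theory Defs
  imports "HOL-Probability.Probability"
begin

text \<open>
  A real process indexed by the line is a family \<open>f :: real \<Rightarrow> 'a \<Rightarrow> real\<close> of random variables on
  a probability space \<open>M\<close>; the trajectory of the outcome \<open>\<omega>\<close> is \<open>\<lambda>x. f x \<omega>\<close>.
\<close>

text \<open>Constants count as (degenerate) Gaussian variables.\<close>

definition gaussian_variable :: "'a measure \<Rightarrow> ('a \<Rightarrow> real) \<Rightarrow> bool" where
  "gaussian_variable M X \<longleftrightarrow>
     X \<in> borel_measurable M \<and>
     ((\<exists>m. AE \<omega> in M. X \<omega> = m) \<or>
      (\<exists>m \<sigma>. 0 < \<sigma> \<and> distributed M lborel X (\<lambda>x. ennreal (normal_density m \<sigma> x))))"

definition gaussian_process :: "'a measure \<Rightarrow> (real \<Rightarrow> 'a \<Rightarrow> real) \<Rightarrow> bool" where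
  "gaussian_process M f \<longleftrightarrow>
     (\<forall>I c. finite I \<longrightarrow> gaussian_variable M (\<lambda>\<omega>. \<Sum>x\<in>I. c x * f x \<omega>))"

definition centered_process :: "'a measure \<Rightarrow> (real \<Rightarrow> 'a \<Rightarrow> real) \<Rightarrow> bool" where
  "centered_process M f \<longleftrightarrow> (\<forall>x. integrable M (f x) \<and> (\<integral>\<omega>. f x \<omega> \<partial>M) = 0)"

definition stationary_process :: "'a measure \<Rightarrow> (real \<Rightarrow> 'a \<Rightarrow> real) \<Rightarrow> bool" where
  "stationary_process M f \<longleftrightarrow>
     (\<forall>I h. finite I \<longrightarrow>
        distr M (\<Pi>\<^sub>M x\<in>I. borel) (\<lambda>\<omega>. \<lambda>x\<in>I. f (x + h) \<omega>) =
        distr M (\<Pi>\<^sub>M x\<in>I. borel) (\<lambda>\<omega>. \<lambda>x\<in>I. f x \<omega>))"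

definition C1_process :: "'a measure \<Rightarrow> (real \<Rightarrow> 'a \<Rightarrow> real) \<Rightarrow> bool" where
  "C1_process M f \<longleftrightarrow> (AE \<omega> in M. (\<lambda>x. f x \<omega>) C1_differentiable_on UNIV)"

definition correlation :: "'a measure \<Rightarrow> (real \<Rightarrow> 'a \<Rightarrow> real) \<Rightarrow> real \<Rightarrow> real" where
  "correlation M f x = (\<integral>\<omega>. f 0 \<omega> * f x \<omega> \<partial>M)"

text \<open>
  \<open>\<kappa> 0 = 1 = - \<kappa>'' 0\<close>. Since \<open>deriv\<close> is unspecified where the derivative does not exist, the
  existence of \<open>\<kappa>'\<close> near \<open>0\<close> and of \<open>\<kappa>''\<close> at \<open>0\<close> is spelled out.
\<close>

definition normalized_process :: "'a measure \<Rightarrow> (real \<Rightarrow> 'a \<Rightarrow> real) \<Rightarrow> bool" where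
  "normalized_process M f \<longleftrightarrow>
     correlation M f 0 = 1 \<and>
     (\<forall>\<^sub>F x in nhds 0. correlation M f field_differentiable at x) \<and>
     (deriv (correlation M f) has_real_derivative - 1) (at 0)"

text \<open>
  The sum of the Dirac masses at the points \<open>x\<close> with \<open>f (R * x) \<omega> = 0\<close>. Integration against it is
  summation over these points, see the lemmas below.
\<close>

definition zero_measure :: "(real \<Rightarrow> 'a \<Rightarrow> real) \<Rightarrow> real \<Rightarrow> 'a \<Rightarrow> real measure" where
  "zero_measure f R \<omega> = distr (count_space {x. f (R * x) \<omega> = 0}) borel (\<lambda>x. x)"

lemma nn_integral_count_space_eq_infsum:
  fixes h :: "'b \<Rightarrow> ennreal"
  shows "(\<integral>\<^sup>+x. h x \<partial>count_space A) = (\<Sum>\<^sub>\<infinity>x\<in>A. h x)"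
proof (rule antisym)
  have le: "sum h F \<le> (\<Sum>\<^sub>\<infinity>x\<in>A. h x)" if "finite F" "F \<subseteq> A" for F
    using that by (subst nonneg_infsum_complete) (auto intro!: SUP_upper)
  show "(\<Sum>\<^sub>\<infinity>x\<in>A. h x) \<le> (\<integral>\<^sup>+x. h x \<partial>count_space A)"
  proof (rule infsum_le_finite_sums)
    show "h summable_on A" by (simp add: nonneg_summable_on_complete)
    fix F assume F: "finite F" "F \<subseteq> A"
    have "sum h F = (\<integral>\<^sup>+x. h x \<partial>count_space F)"
      using F by (simp add: nn_integral_count_space_finite)
    also have "\<dots> = (\<integral>\<^sup>+x. h x * indicator F x \<partial>count_space A)"
      using F by (simp add: nn_integral_count_space_indicator[of F] nn_integral_count_space_indicator[of A])
        (intro nn_integral_cong, auto simp: indicator_def)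
    also have "\<dots> \<le> (\<integral>\<^sup>+x. h x \<partial>count_space A)"
      by (intro nn_integral_mono) (auto simp: indicator_def)
    finally show "sum h F \<le> (\<integral>\<^sup>+x. h x \<partial>count_space A)" .
  qed
  show "(\<integral>\<^sup>+x. h x \<partial>count_space A) \<le> (\<Sum>\<^sub>\<infinity>x\<in>A. h x)"
  proof (cases "(\<Sum>\<^sub>\<infinity>x\<in>A. h x) = \<top>")
    case False
    define S where "S = (\<Sum>\<^sub>\<infinity>x\<in>A. h x)"
    define r where "r x = enn2real (h x)" for x
    have S: "S < \<top>" using False by (simp add: S_def top.not_eq_extremum)
    have hr: "ennreal (r x) = h x" if "x \<in> A" for x
    proof -
      have "h x \<le> S" using le[of "{x}"] that by (simp add: S_def)
      then show ?thesis using S by (auto simp: r_def intro!: ennreal_enn2real)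
    qed
    have sumr: "ennreal (sum r F) = sum h F" if "F \<subseteq> A" for F
    proof -
      have "ennreal (sum r F) = (\<Sum>x\<in>F. ennreal (r x))" by (simp add: r_def sum_ennreal)
      also have "\<dots> = sum h F" using that hr by (intro sum.cong) auto
      finally show ?thesis .
    qed
    have bd: "sum r F \<le> enn2real S" if "finite F" "F \<subseteq> A" for F
    proof -
      have "ennreal (sum r F) \<le> ennreal (enn2real S)"
        using le[OF that] S sumr[OF that(2)] by (simp add: S_def)
      then show ?thesis by (simp add: ennreal_le_iff)
    qed
    have s: "r summable_on A"
      by (rule nonneg_bdd_above_summable_on) (auto simp: r_def[symmetric] intro!: bdd_aboveI2 bd, simp add: r_def)
    have as: "Infinite_Set_Sum.abs_summable_on r A"
      using s by (metis abs_summable_equivalent summable_on_iff_abs_summable_on_real)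
    have "(\<integral>\<^sup>+x. h x \<partial>count_space A) = (\<integral>\<^sup>+x. ennreal (r x) \<partial>count_space A)"
      by (intro nn_integral_cong) (simp add: hr)
    also have "\<dots> = ennreal (infsetsum r A)"
      using as by (intro nn_integral_conv_infsetsum) (auto simp: r_def)
    also have "infsetsum r A = infsum r A" using as by (rule infsetsum_infsum)
    also have "ennreal (infsum r A) \<le> ennreal (enn2real S)"
      by (intro ennreal_leI infsum_le_finite_sums s bd)
    also have "\<dots> = S" using S by simp
    finally show ?thesis by (simp add: S_def)
  qed simp
qed

lemma nn_integral_zero_measure:
  fixes \<phi> :: "real \<Rightarrow> ennreal"
  assumes "\<phi> \<in> borel_measurable borel"
  shows "(\<integral>\<^sup>+x. \<phi> x \<partial>zero_measure f R \<omega>) = (\<Sum>\<^sub>\<infinity>x\<in>{x. f (R * x) \<omega> = 0}. \<phi> x)"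
  unfolding zero_measure_def using assms
  by (simp add: nn_integral_distr nn_integral_count_space_eq_infsum)

lemma integrable_zero_measure:
  fixes \<phi> :: "real \<Rightarrow> real"
  assumes "\<phi> \<in> borel_measurable borel"
  shows "integrable (zero_measure f R \<omega>) \<phi> \<longleftrightarrow>
         (\<lambda>x. \<bar>\<phi> x\<bar>) summable_on {x. f (R * x) \<omega> = 0}"
  unfolding zero_measure_def using assms
  by (simp add: integrable_distr_eq Infinite_Set_Sum.abs_summable_on_def[symmetric]
      abs_summable_equivalent[symmetric] flip: real_norm_def)

lemma integral_zero_measure:
  fixes \<phi> :: "real \<Rightarrow> real"
  assumes "\<phi> \<in> borel_measurable borel"
  shows "(\<integral>x. \<phi> x \<partial>zero_measure f R \<omega>) = (\<Sum>\<^sub>\<infinity>x\<in>{x. f (R * x) \<omega> = 0}. \<phi> x)"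
proof -
  let ?Z = "{x. f (R * x) \<omega> = 0}"
  have "(\<integral>x. \<phi> x \<partial>zero_measure f R \<omega>) = infsetsum \<phi> ?Z"
    unfolding zero_measure_def infsetsum_def using assms by (simp add: integral_distr)
  also have "\<dots> = (\<Sum>\<^sub>\<infinity>x\<in>?Z. \<phi> x)"
  proof (cases "Infinite_Set_Sum.abs_summable_on \<phi> ?Z")
    case True
    then show ?thesis by (rule infsetsum_infsum)
  next
    case False
    then show ?thesis
      by (metis abs_summable_equivalent infsum_not_exists not_summable_infsetsum_eq
          summable_on_iff_abs_summable_on_real)
  qed
  finally show ?thesis .
qed

text \<open>On the line, a Borel measure finite on compact sets is automatically regular.\<close>

definition radon_measure :: "real measure \<Rightarrow> bool" where
  "radon_measure \<mu> \<longleftrightarrow> sets \<mu> = sets borel \<and> (\<forall>K. compact K \<longrightarrow> emeasure \<mu> K < \<infinity>)"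

text \<open>
  The Radon measure \<open>\<mu>\<close> is the expectation of the random measure \<open>N\<close> if it is characterised by
  \<open>\<langle>\<mu>, \<phi>\<rangle> = E \<langle>N, \<phi>\<rangle>\<close> for continuous compactly supported \<open>\<phi>\<close>. As properties of \<open>N\<close> are typically
  only available almost surely, outside a null set that need not be measurable, expectations are
  taken with respect to the completion of \<open>M\<close>; for \<open>M\<close>-measurable variables this does not change
  their value.
\<close>

definition is_mean_measure :: "'a measure \<Rightarrow> ('a \<Rightarrow> real measure) \<Rightarrow> real measure \<Rightarrow> bool" where
  "is_mean_measure M N \<mu> \<longleftrightarrow>
     radon_measure \<mu> \<and>
     (\<forall>\<phi> :: real \<Rightarrow> real. continuous_on UNIV \<phi> \<and> compact (closure {x. \<phi> x \<noteq> 0}) \<longrightarrow>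
        (AE \<omega> in M. integrable (N \<omega>) \<phi>) \<and>
        integrable (completion M) (\<lambda>\<omega>. \<integral>x. \<phi> x \<partial>N \<omega>) \<and>
        (\<integral>x. \<phi> x \<partial>\<mu>) = (\<integral>\<omega>. (\<integral>x. \<phi> x \<partial>N \<omega>) \<partial>completion M))"

definition mean_measure :: "'a measure \<Rightarrow> ('a \<Rightarrow> real measure) \<Rightarrow> real measure" where
  "mean_measure M N = (THE \<mu>. is_mean_measure M N \<mu>)"

end

theory Submission
  imports Defs
begin

text \<open>
  Almost surely \<open>f\<close> has no double zero (Bulinskaya's lemma), so the number of zeros in an interval is
  the limit of the number of sign changes between consecutive points of finer and finer grids, and it
  bounds each of these numbers. By Sheppard's formula and stationarity, a sign change over a distance
  \<open>h\<close> has probability \<open>arccos (\<kappa> h) / \<pi>\<close>, which is equivalent to \<open>h / \<pi>\<close> because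
  \<open>\<kappa> h = 1 - h\<^sup>2 / 2 + o(h\<^sup>2)\<close>. Hence intervals contain on average \<open>R / \<pi>\<close> zeros of \<open>f (R x)\<close> per unit
  of length, and this determines the mean measure.
\<close>

section \<open>Characteristic functions and independence\<close>

text \<open>Almost sure convergence of the sign change counts does not by itself carry over to
  expectations: consecutive grids are not nested, so monotone convergence does not apply, and no
  integrable bound is known beforehand. Fatou's lemma gives one inequality for the mean number of
  zeros, and the bound of every single count by the number of zeros gives the other. The number of
  zeros is a limit of measurable counts only outside a null set, so random integrals are handled on
  the completion of \<open>M\<close>, where almost sure equality preserves measurability.
  Gaussianity is given as a property of linear combinations only. The joint law of
  \<open>f 0\<close> and \<open>f h\<close> is therefore reached through characteristic functions,
  whose factorization gives independence. In the constant \<open>R / pi\<close>, the factor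
  \<open>1 / pi\<close> comes from the angle in Sheppard's formula, normalization makes this angle
  equivalent to the lag, and \<open>R\<close> is the change of scale of the lag.\<close>

lemma (in prob_space) char_distr:
  assumes [measurable]: "X \<in> borel_measurable M"
  shows "char (distr M borel X) t = (CLINT \<omega>|M. iexp (t * X \<omega>))"
  unfolding char_def by (subst integral_distr) auto

lemma (in prob_space) char_std_normal:
  assumes "distributed M lborel X std_normal_density"
  shows "(CLINT \<omega>|M. iexp (t * X \<omega>)) = exp (- t\<^sup>2 / 2)"
proof -
  have [measurable]: "X \<in> borel_measurable M"
    using distributed_measurable[OF assms] by simp
  have "distr M borel X = distr M lborel X"
    by (intro distr_cong) auto
  also have "\<dots> = std_normal_distribution"
    using assms by (simp add: distributed_def)
  finally show ?thesis
    using char_distr[of X t] by (simp add: char_std_normal_distribution)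
qed

text \<open>The mean square is \<open>0\<close> in the degenerate case, so one formula covers both cases.\<close>

lemma (in prob_space) centered_gaussian_variable:
  assumes "gaussian_variable M X" and "expectation X = 0"
  shows "integrable M (\<lambda>\<omega>. (X \<omega>)\<^sup>2)"
    and "(CLINT \<omega>|M. iexp (X \<omega>)) = exp (- expectation (\<lambda>\<omega>. (X \<omega>)\<^sup>2) / 2)"
    and "expectation (\<lambda>\<omega>. (X \<omega>)\<^sup>2) = 1 \<Longrightarrow> distributed M lborel X std_normal_density"
proof -
  have [measurable]: "X \<in> borel_measurable M"
    using assms(1) by (simp add: gaussian_variable_def)
  have "integrable M (\<lambda>\<omega>. (X \<omega>)\<^sup>2) \<and>
    (CLINT \<omega>|M. iexp (X \<omega>)) = exp (- expectation (\<lambda>\<omega>. (X \<omega>)\<^sup>2) / 2) \<and>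
    (expectation (\<lambda>\<omega>. (X \<omega>)\<^sup>2) = 1 \<longrightarrow> distributed M lborel X std_normal_density)"
  proof (cases "\<exists>m. AE \<omega> in M. X \<omega> = m")
    case True
    then obtain m where m: "AE \<omega> in M. X \<omega> = m" by blast
    then have "expectation X = expectation (\<lambda>_. m)"
      by (intro integral_cong_AE) auto
    then have "m = 0" using assms(2) by (simp add: prob_space)
    with m have ae: "AE \<omega> in M. X \<omega> = 0" by simp
    have "expectation (\<lambda>\<omega>. (X \<omega>)\<^sup>2) = expectation (\<lambda>_. 0)"
      using ae by (intro integral_cong_AE) auto
    then have sq: "expectation (\<lambda>\<omega>. (X \<omega>)\<^sup>2) = 0" by simp
    have int: "integrable M (\<lambda>\<omega>. (X \<omega>)\<^sup>2)"
      by (subst integrable_cong_AE[where g = "\<lambda>_. 0"]) (use ae in auto)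
    have "(CLINT \<omega>|M. iexp (X \<omega>)) = (CLINT \<omega>|M. 1)"
      using ae by (intro integral_cong_AE) auto
    with sq int show ?thesis by (simp add: prob_space)
  next
    case False
    then obtain m \<sigma> where "0 < \<sigma>" and D: "distributed M lborel X (normal_density m \<sigma>)"
      using assms(1) unfolding gaussian_variable_def by blast
    have "m = 0"
      using normal_distributed_expectation[OF \<open>0 < \<sigma>\<close> D] assms(2) by simp
    have int: "integrable M (\<lambda>\<omega>. (X \<omega>)\<^sup>2)"
      using distributed_integrable[OF D, of "\<lambda>x. x\<^sup>2"] integrable_normal_moment[OF \<open>0 < \<sigma>\<close>, of 0 2] \<open>m = 0\<close>
      by simp
    have sq: "expectation (\<lambda>\<omega>. (X \<omega>)\<^sup>2) = \<sigma>\<^sup>2"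
      using normal_distributed_variance[OF \<open>0 < \<sigma>\<close> D] assms(2) by simp
    have "distributed M lborel (\<lambda>\<omega>. X \<omega> / \<sigma>) std_normal_density"
      using normal_standard_normal_convert[OF \<open>0 < \<sigma>\<close>, of X m] D \<open>m = 0\<close> by simp
    from char_std_normal[OF this, of \<sigma>]
    have "(CLINT \<omega>|M. iexp (X \<omega>)) = exp (- \<sigma>\<^sup>2 / 2)"
      using \<open>0 < \<sigma>\<close> by simp
    moreover have "\<sigma> = 1" if "\<sigma>\<^sup>2 = 1"
      using that \<open>0 < \<sigma>\<close> by (simp add: power2_eq_1_iff)
    ultimately show ?thesis
      using int sq D \<open>m = 0\<close> by auto
  qed
  then show "integrable M (\<lambda>\<omega>. (X \<omega>)\<^sup>2)"
    and "(CLINT \<omega>|M. iexp (X \<omega>)) = exp (- expectation (\<lambda>\<omega>. (X \<omega>)\<^sup>2) / 2)"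
    and "expectation (\<lambda>\<omega>. (X \<omega>)\<^sup>2) = 1 \<Longrightarrow> distributed M lborel X std_normal_density"
    by auto
qed

text \<open>Under the probability measure with density \<open>h\<close>, the variable
  \<open>X\<close> keeps its characteristic function, hence its law by Levy's theorem. Statements
  about two variables are thus reduced to uniqueness for one variable: the second variable hides in
  the weight.\<close>

lemma (in prob_space) weighted_law_eqI:
  fixes X h :: "'a \<Rightarrow> real"
  assumes [measurable]: "X \<in> borel_measurable M" "h \<in> borel_measurable M"
    and h: "\<And>\<omega>. 0 \<le> h \<omega>" "integrable M h" "expectation h = 1"
    and char: "\<And>t. (CLINT \<omega>|M. h \<omega> *\<^sub>R iexp (t * X \<omega>)) = (CLINT \<omega>|M. iexp (t * X \<omega>))"
    and A [measurable]: "A \<in> sets borel"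
  shows "expectation (\<lambda>\<omega>. h \<omega> * indicator A (X \<omega>)) = expectation (\<lambda>\<omega>. indicator A (X \<omega>))"
proof -
  let ?D = "density M (\<lambda>\<omega>. ennreal (h \<omega>))"
  have "(\<integral>\<^sup>+\<omega>. ennreal (h \<omega>) \<partial>M) = ennreal 1"
    using h by (subst nn_integral_eq_integral) auto
  then interpret D: prob_space ?D
    by (intro prob_spaceI) (simp add: emeasure_density cong: nn_integral_cong)
  have "distr ?D borel X = distr M borel X"
  proof (rule Levy_uniqueness)
    show "real_distribution (distr ?D borel X)"
      by (intro D.real_distribution_distr) simp
    show "char (distr ?D borel X) = char (distr M borel X)"
    proof
      fix t
      show "char (distr ?D borel X) t = char (distr M borel X) t"
        using char[of t] h(1)
        by (subst D.char_distr, simp, subst char_distr, simp, subst integral_density) auto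
    qed
  qed simp
  then have eq: "(\<integral>x. indicator A x \<partial>distr ?D borel X) = (\<integral>x. (indicator A x::real) \<partial>distr M borel X)"
    by simp
  have "expectation (\<lambda>\<omega>. h \<omega> * indicator A (X \<omega>)) = (\<integral>\<omega>. indicator A (X \<omega>) \<partial>?D)"
    using h(1) by (subst integral_density) auto
  also have "\<dots> = (\<integral>x. indicator A x \<partial>distr ?D borel X)"
    by (subst integral_distr) auto
  also have "\<dots> = expectation (\<lambda>\<omega>. indicator A (X \<omega>))"
    unfolding eq by (subst integral_distr) auto
  finally show ?thesis .
qed

lemma iexp_integral_parts:
  assumes "integrable M (\<lambda>\<omega>. iexp (X \<omega>))"
  shows "(CLINT \<omega>|M. iexp (X \<omega>)) = complex_of_real (\<integral>\<omega>. cos (X \<omega>) \<partial>M) + \<i> * (\<integral>\<omega>. sin (X \<omega>) \<partial>M)"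
proof -
  have "Re (CLINT \<omega>|M. iexp (X \<omega>)) = (\<integral>\<omega>. Re (iexp (X \<omega>)) \<partial>M)"
    using integral_Re[OF assms] by simp
  moreover have "Im (CLINT \<omega>|M. iexp (X \<omega>)) = (\<integral>\<omega>. Im (iexp (X \<omega>)) \<partial>M)"
    using integral_Im[OF assms] by simp
  ultimately show ?thesis
    by (simp add: complex_eq_iff Re_exp Im_exp)
qed


lemma (in prob_space) integrable_iexp:
  assumes [measurable]: "X \<in> borel_measurable M" "h \<in> borel_measurable M" and "\<And>\<omega>. \<bar>h \<omega>\<bar> \<le> (B::real)"
  shows "integrable M (\<lambda>\<omega>. h \<omega> *\<^sub>R iexp (X \<omega>))"
  by (rule integrable_const_bound[where B = B]) (use assms(3) in auto)

text \<open>\<open>G\<close> may change sign and so cannot serve as a density, but a positive affine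
  function of it can. \<open>weighted_law_eqI\<close> applies to that function, and linearity leads
  back to \<open>G\<close>.\<close>

lemma (in prob_space) uncorrelated_char_imp_indicator:
  fixes X G :: "'a \<Rightarrow> real"
  assumes [measurable]: "X \<in> borel_measurable M" "G \<in> borel_measurable M"
    and G: "\<And>\<omega>. \<bar>G \<omega>\<bar> \<le> 1"
    and char: "\<And>t. (CLINT \<omega>|M. G \<omega> *\<^sub>R iexp (t * X \<omega>)) = expectation G *\<^sub>R (CLINT \<omega>|M. iexp (t * X \<omega>))"
    and A [measurable]: "A \<in> sets borel"
  shows "expectation (\<lambda>\<omega>. G \<omega> * indicator A (X \<omega>)) = expectation G * expectation (\<lambda>\<omega>. indicator A (X \<omega>))"
proof -
  \<comment> \<open>Since \<open>G\<close> is at least -1, the weight \<open>2 + G\<close> has a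
    positive mean; the mean of \<open>1 + G\<close> could vanish.\<close>
  define c where "c = 2 + expectation G"
  define h where "h \<omega> = (2 + G \<omega>) / c" for \<omega>
  have intG [simp]: "integrable M G"
    by (rule integrable_const_bound[where B = 1]) (use G in auto)
  have "-1 \<le> G \<omega>" for \<omega> using G[of \<omega>] by linarith
  then have "-1 \<le> expectation G"
    using integral_mono[of M "\<lambda>_. -1" G] by (simp add: prob_space)
  then have c: "c > 0" by (simp add: c_def)
  have [measurable]: "h \<in> borel_measurable M" by (simp add: h_def[abs_def])
  have eq: "expectation (\<lambda>\<omega>. h \<omega> * indicator A (X \<omega>)) = expectation (\<lambda>\<omega>. indicator A (X \<omega>))"
  proof (rule weighted_law_eqI)
    show "0 \<le> h \<omega>" for \<omega> using G[of \<omega>] c by (simp add: h_def)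
    show "integrable M h" unfolding h_def by simp
    show "expectation h = 1"
      using c by (simp add: h_def[abs_def] prob_space c_def)
    show "(CLINT \<omega>|M. h \<omega> *\<^sub>R iexp (t * X \<omega>)) = (CLINT \<omega>|M. iexp (t * X \<omega>))" for t
    proof -
      have i: "integrable M (\<lambda>\<omega>. G \<omega> *\<^sub>R iexp (t * X \<omega>))" "integrable M (\<lambda>\<omega>. iexp (t * X \<omega>))"
        using integrable_iexp[of "\<lambda>\<omega>. t * X \<omega>" G 1] integrable_iexp[of "\<lambda>\<omega>. t * X \<omega>" "\<lambda>_. 1" 1] G by auto
      have "(CLINT \<omega>|M. h \<omega> *\<^sub>R iexp (t * X \<omega>))
          = (CLINT \<omega>|M. (1 / c) *\<^sub>R (2 *\<^sub>R iexp (t * X \<omega>) + G \<omega> *\<^sub>R iexp (t * X \<omega>)))"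
        by (intro Bochner_Integration.integral_cong) (auto simp: h_def scaleR_conv_of_real add_divide_distrib field_simps)
      also have "\<dots> = (1 / c) *\<^sub>R (2 *\<^sub>R (CLINT \<omega>|M. iexp (t * X \<omega>)) + (CLINT \<omega>|M. G \<omega> *\<^sub>R iexp (t * X \<omega>)))"
        using i by (simp only: integral_scaleR_right Bochner_Integration.integral_add integrable_scaleR_right)
      also have "\<dots> = (1 / c) *\<^sub>R (c *\<^sub>R (CLINT \<omega>|M. iexp (t * X \<omega>)))"
        by (simp only: char c_def scaleR_add_left)
      also have "\<dots> = (CLINT \<omega>|M. iexp (t * X \<omega>))" using c by simp
      finally show ?thesis .
    qed
  qed auto
  have j: "integrable M (\<lambda>\<omega>. indicat_real A (X \<omega>))" "integrable M (\<lambda>\<omega>. G \<omega> * indicat_real A (X \<omega>))"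
    by (rule integrable_const_bound[where B = 1], use G in \<open>auto simp: indicator_def\<close>)+
  have "expectation (\<lambda>\<omega>. h \<omega> * indicator A (X \<omega>))
    = expectation (\<lambda>\<omega>. (1 / c) * (2 * indicator A (X \<omega>) + G \<omega> * indicator A (X \<omega>)))"
    by (intro Bochner_Integration.integral_cong) (auto simp: h_def field_simps)
  also have "\<dots> = (1 / c) * (2 * expectation (\<lambda>\<omega>. indicator A (X \<omega>)) + expectation (\<lambda>\<omega>. G \<omega> * indicator A (X \<omega>)))"
    using j by (simp del: Bochner_Integration.integral_indicator integral_indicator add: Bochner_Integration.integral_add)
  finally show ?thesis
    using c eq by (simp add: field_simps c_def del: Bochner_Integration.integral_indicator)
qed

text \<open>Exponentials are replaced by indicators one variable at a time: first
  \<open>cos (b * Y)\<close> and \<open>sin (b * Y)\<close> are the weights and indicators of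
  \<open>X\<close> are obtained, then an indicator of \<open>X\<close> is the weight and indicators
  of \<open>Y\<close> are obtained.\<close>

lemma (in prob_space) indep_var_char:
  fixes X Y :: "'a \<Rightarrow> real"
  assumes [measurable]: "X \<in> borel_measurable M" "Y \<in> borel_measurable M"
    and char: "\<And>a b. (CLINT \<omega>|M. iexp (a * X \<omega> + b * Y \<omega>))
      = (CLINT \<omega>|M. iexp (a * X \<omega>)) * (CLINT \<omega>|M. iexp (b * Y \<omega>))"
  shows "indep_var borel X borel Y"
proof -
  have i: "integrable M (\<lambda>\<omega>. iexp (W \<omega>))" if "W \<in> borel_measurable M" for W :: "'a \<Rightarrow> real"
    using integrable_iexp[of W "\<lambda>_. 1" 1] that by simp
  have cs: "(CLINT \<omega>|M. cos (b * Y \<omega>) *\<^sub>R iexp (a * X \<omega>)) = expectation (\<lambda>\<omega>. cos (b * Y \<omega>)) *\<^sub>R (CLINT \<omega>|M. iexp (a * X \<omega>))"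
    "(CLINT \<omega>|M. sin (b * Y \<omega>) *\<^sub>R iexp (a * X \<omega>)) = expectation (\<lambda>\<omega>. sin (b * Y \<omega>)) *\<^sub>R (CLINT \<omega>|M. iexp (a * X \<omega>))"
    for a b
  proof -
    let ?C = "expectation (\<lambda>\<omega>. cos (b * Y \<omega>))" and ?S = "expectation (\<lambda>\<omega>. sin (b * Y \<omega>))"
    let ?E = "\<lambda>b. (CLINT \<omega>|M. iexp (a * X \<omega> + b * Y \<omega>))"
    have p: "(CLINT \<omega>|M. iexp (b * Y \<omega>)) = ?C + \<i> * ?S"
      by (intro iexp_integral_parts i) simp
    have m: "(CLINT \<omega>|M. iexp ((-b) * Y \<omega>)) = ?C - \<i> * ?S"
      using iexp_integral_parts[OF i, of "\<lambda>\<omega>. (-b) * Y \<omega>"] by simp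
    \<comment> \<open>By Euler's formulas cosine and sine combine the exponentials at
      \<open>b\<close> and \<open>-b\<close>, so the factorization is used at both.\<close>
    have "(CLINT \<omega>|M. cos (b * Y \<omega>) *\<^sub>R iexp (a * X \<omega>))
      = (CLINT \<omega>|M. (1/2) * (iexp (a * X \<omega> + b * Y \<omega>) + iexp (a * X \<omega> + (-b) * Y \<omega>)))"
      by (intro Bochner_Integration.integral_cong)
        (auto simp: complex_eq_iff Re_exp Im_exp cos_add sin_add cos_diff sin_diff field_simps)
    also have "\<dots> = (1/2) * (?E b + ?E (-b))"
      by (subst integral_mult_right_zero, subst Bochner_Integration.integral_add) (auto intro!: i simp del: of_real_add of_real_diff)
    also have "\<dots> = ?C *\<^sub>R (CLINT \<omega>|M. iexp (a * X \<omega>))"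
      unfolding char p m by (simp add: algebra_simps scaleR_conv_of_real)
    finally show "(CLINT \<omega>|M. cos (b * Y \<omega>) *\<^sub>R iexp (a * X \<omega>)) = ?C *\<^sub>R (CLINT \<omega>|M. iexp (a * X \<omega>))" .
    have "(CLINT \<omega>|M. sin (b * Y \<omega>) *\<^sub>R iexp (a * X \<omega>))
      = (CLINT \<omega>|M. (-\<i>/2) * (iexp (a * X \<omega> + b * Y \<omega>) - iexp (a * X \<omega> + (-b) * Y \<omega>)))"
      by (intro Bochner_Integration.integral_cong)
        (auto simp: complex_eq_iff Re_exp Im_exp cos_add sin_add cos_diff sin_diff field_simps)
    also have "\<dots> = (-\<i>/2) * (?E b - ?E (-b))"
      by (subst integral_mult_right_zero, subst Bochner_Integration.integral_diff) (auto intro!: i simp del: of_real_add of_real_diff)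
    also have "\<dots> = ?S *\<^sub>R (CLINT \<omega>|M. iexp (a * X \<omega>))"
      unfolding char p m by (simp add: algebra_simps scaleR_conv_of_real)
    finally show "(CLINT \<omega>|M. sin (b * Y \<omega>) *\<^sub>R iexp (a * X \<omega>)) = ?S *\<^sub>R (CLINT \<omega>|M. iexp (a * X \<omega>))" .
  qed
  have prod: "expectation (\<lambda>\<omega>. indicat_real A (X \<omega>) * indicator B (Y \<omega>))
      = expectation (\<lambda>\<omega>. indicator A (X \<omega>)) * expectation (\<lambda>\<omega>. indicator B (Y \<omega>))"
    if [measurable]: "A \<in> sets borel" "B \<in> sets borel" for A B
  proof (rule uncorrelated_char_imp_indicator)
    fix b
    let ?I = "\<lambda>\<omega>. indicat_real A (X \<omega>)"
    have c: "expectation (\<lambda>\<omega>. cos (b * Y \<omega>) * ?I \<omega>) = expectation (\<lambda>\<omega>. cos (b * Y \<omega>)) * expectation ?I"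
      and s: "expectation (\<lambda>\<omega>. sin (b * Y \<omega>) * ?I \<omega>) = expectation (\<lambda>\<omega>. sin (b * Y \<omega>)) * expectation ?I"
      by (intro uncorrelated_char_imp_indicator cs; simp)+
    have int: "integrable M (\<lambda>\<omega>. ?I \<omega> *\<^sub>R iexp (b * Y \<omega>))"
      by (rule integrable_iexp[where B = 1]) (auto simp: indicator_def)
    have "Re (CLINT \<omega>|M. ?I \<omega> *\<^sub>R iexp (b * Y \<omega>)) = expectation (\<lambda>\<omega>. cos (b * Y \<omega>) * ?I \<omega>)"
      using integral_Re[OF int] by (simp add: Re_exp mult.commute)
    moreover have "Im (CLINT \<omega>|M. ?I \<omega> *\<^sub>R iexp (b * Y \<omega>)) = expectation (\<lambda>\<omega>. sin (b * Y \<omega>) * ?I \<omega>)"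
      using integral_Im[OF int] by (simp add: Im_exp mult.commute)
    moreover have "(CLINT \<omega>|M. iexp (b * Y \<omega>))
      = expectation (\<lambda>\<omega>. cos (b * Y \<omega>)) + \<i> * expectation (\<lambda>\<omega>. sin (b * Y \<omega>))"
      by (intro iexp_integral_parts i) simp
    ultimately show "(CLINT \<omega>|M. ?I \<omega> *\<^sub>R iexp (b * Y \<omega>)) = expectation ?I *\<^sub>R (CLINT \<omega>|M. iexp (b * Y \<omega>))"
      using c s by (simp add: complex_eq_iff mult.commute)
  qed (auto simp: indicator_def)
  have ind: "expectation (\<lambda>\<omega>. indicat_real C (Z \<omega>)) = prob (Z -` C \<inter> space M)"
    if [measurable]: "Z \<in> borel_measurable M" "C \<in> sets borel" for Z :: "'a \<Rightarrow> real" and C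
  proof -
    have "expectation (\<lambda>\<omega>. indicat_real C (Z \<omega>)) = expectation (indicator (Z -` C \<inter> space M))"
      by (intro Bochner_Integration.integral_cong) (auto simp: indicator_def)
    then show ?thesis by simp
  qed
  have "prob ((X -` A \<inter> space M) \<inter> (Y -` B \<inter> space M)) = prob (X -` A \<inter> space M) * prob (Y -` B \<inter> space M)"
    if [measurable]: "A \<in> sets borel" "B \<in> sets borel" for A B
  proof -
    have "expectation (\<lambda>\<omega>. indicat_real A (X \<omega>) * indicator B (Y \<omega>))
      = expectation (indicator ((X -` A \<inter> space M) \<inter> (Y -` B \<inter> space M)))"
      by (intro Bochner_Integration.integral_cong) (auto simp: indicator_def)
    then show ?thesis using prod[of A B] by (simp add: ind)
  qed
  moreover have "Int_stable {Z -` C \<inter> space M |C. C \<in> sets borel}" for Z :: "'a \<Rightarrow> real"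
  proof (safe intro!: Int_stableI)
    fix A B :: "real set" assume "A \<in> sets borel" "B \<in> sets borel"
    then show "\<exists>C. (Z -` A \<inter> space M) \<inter> (Z -` B \<inter> space M) = Z -` C \<inter> space M \<and> C \<in> sets borel"
      by (intro exI[of _ "A \<inter> B"]) auto
  qed
  ultimately show ?thesis
    unfolding indep_var_eq
    by (intro conjI indep_set_sigma_sets indep_setI) auto
qed

section \<open>Sign changes of a pair of Gaussian variables\<close>

text \<open>Up to a factor, the product of the two densities is the centered normal density in
  \<open>u\<close> of variance \<open>1 / (1 + t\<^sup>2)\<close>, so the integral is a first
  absolute moment. The absolute value of \<open>u\<close> is the Jacobian of
  \<open>v = u * t\<close>, and the result is the Cauchy density, the law of the ratio of two
  independent standard normal variables.\<close>

lemma integral_abs_normal_product: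
  "(\<integral>\<^sup>+u. ennreal (\<bar>u\<bar> * (std_normal_density u * std_normal_density (u * t))) \<partial>lborel)
    = ennreal (1 / (pi * (1 + t\<^sup>2)))"
proof -
  define \<sigma> where "\<sigma> = 1 / sqrt (1 + t\<^sup>2)"
  have pos: "0 < 1 + t\<^sup>2" by (simp add: add_pos_nonneg)
  have \<sigma>: "\<sigma> > 0" "\<sigma>\<^sup>2 = 1 / (1 + t\<^sup>2)"
    using pos by (simp_all add: \<sigma>_def power_divide)
  have eq: "\<bar>u\<bar> * (std_normal_density u * std_normal_density (u * t))
      = (\<sigma> / sqrt (2 * pi)) * (normal_density 0 \<sigma> u * \<bar>u - 0\<bar> ^ (2 * 0 + 1))" for u
  proof -
    have "sqrt (2 * pi * \<sigma>\<^sup>2) = \<sigma> * sqrt (2 * pi)"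
      using \<sigma>(1) by (simp add: real_sqrt_mult)
    then have "normal_density 0 \<sigma> u = 1 / (\<sigma> * sqrt (2 * pi)) * exp (- (u\<^sup>2 / (2 * \<sigma>\<^sup>2)))"
      by (simp add: normal_density_def)
    moreover have "u\<^sup>2 / (2 * \<sigma>\<^sup>2) = u\<^sup>2 / 2 + (u * t)\<^sup>2 / 2"
      unfolding \<sigma>(2) using pos by (simp add: power_mult_distrib distrib_left add_divide_distrib)
    then have "exp (- (u\<^sup>2 / (2 * \<sigma>\<^sup>2))) = exp (- u\<^sup>2 / 2) * exp (- (u * t)\<^sup>2 / 2)"
      unfolding exp_add[symmetric] by simp
    ultimately show ?thesis
      using \<sigma>(1) unfolding std_normal_density_def by simp
  qed
  have "has_bochner_integral lborel (\<lambda>u. \<bar>u\<bar> * (std_normal_density u * std_normal_density (u * t)))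
      ((\<sigma> / sqrt (2 * pi)) * (\<sigma> * sqrt (2 / pi)))"
    unfolding eq
    using normal_moment_abs_odd[OF \<sigma>(1), of 0 0]
    by (intro has_bochner_integral_mult_right) simp
  also have "(\<sigma> / sqrt (2 * pi)) * (\<sigma> * sqrt (2 / pi)) = \<sigma>\<^sup>2 * (sqrt (2 / pi) / sqrt (2 * pi))"
    by (simp add: power2_eq_square)
  also have "sqrt (2 / pi) / sqrt (2 * pi) = 1 / pi"
  proof -
    have "sqrt (2 / pi) / sqrt (2 * pi) = sqrt ((1 / pi)\<^sup>2)"
      unfolding real_sqrt_divide[symmetric] by (simp add: power2_eq_square)
    then show ?thesis by simp
  qed
  finally have "has_bochner_integral lborel (\<lambda>u. \<bar>u\<bar> * (std_normal_density u * std_normal_density (u * t)))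
      (1 / (pi * (1 + t\<^sup>2)))"
    by (simp add: \<sigma> mult.commute)
  then show ?thesis
    by (subst nn_integral_eq_integral) (auto simp: has_bochner_integral_iff)
qed

text \<open>Computed in the coordinates \<open>(u, v / u)\<close>.\<close>

lemma normal_double_sector:
  fixes r s :: real
  assumes s: "s > 0"
  shows "(\<integral>\<^sup>+u. \<integral>\<^sup>+v. ennreal (std_normal_density u * std_normal_density v)
      * indicator {w. w < 0} (u * (r * u + s * v)) \<partial>lborel \<partial>lborel)
    = ennreal (1 / 2 - arctan (r / s) / pi)"
proof -
  let ?n = std_normal_density
  let ?K = "\<lambda>t. indicator {w. w < 0} (r + s * t) :: ennreal"
  have sub: "(\<integral>\<^sup>+v. ennreal (?n u * ?n v) * indicator {w. w < 0} (u * (r * u + s * v)) \<partial>lborel)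
      = (\<integral>\<^sup>+t. ennreal (\<bar>u\<bar> * (?n u * ?n (u * t))) * ?K t \<partial>lborel)" if "u \<noteq> 0" for u
  proof -
    have "u * (r * u + s * (u * t)) < 0 \<longleftrightarrow> r + s * t < 0" for t
    proof -
      have "u * (r * u + s * (u * t)) = u\<^sup>2 * (r + s * t)"
        by (simp add: algebra_simps power2_eq_square)
      then show ?thesis using that by (simp add: mult_less_0_iff)
    qed
    then have "indicator {w. w < 0} (u * (r * u + s * (u * t))) = ?K t" for t
      by (simp add: indicator_def)
    then show ?thesis
      using that
      by (subst nn_integral_real_affine[where c = u and t = 0])
        (simp_all add: nn_integral_cmult[symmetric] ennreal_mult mult.assoc)
  qed
  have "(\<integral>\<^sup>+u. \<integral>\<^sup>+v. ennreal (?n u * ?n v) * indicator {w. w < 0} (u * (r * u + s * v)) \<partial>lborel \<partial>lborel)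
      = (\<integral>\<^sup>+u. \<integral>\<^sup>+t. ennreal (\<bar>u\<bar> * (?n u * ?n (u * t))) * ?K t \<partial>lborel \<partial>lborel)"
    \<comment> \<open>The substitution \<open>v = u * t\<close> degenerates at \<open>u = 0\<close>,
      a null set.\<close>
    using AE_lborel_singleton[of 0] by (intro nn_integral_cong_AE) (auto simp: sub)
  also have "\<dots> = (\<integral>\<^sup>+t. \<integral>\<^sup>+u. ennreal (\<bar>u\<bar> * (?n u * ?n (u * t))) * ?K t \<partial>lborel \<partial>lborel)"
    by (rule lborel_pair.Fubini') simp
  also have "\<dots> = (\<integral>\<^sup>+t. ennreal (1 / (pi * (1 + t\<^sup>2))) * ?K t \<partial>lborel)"
    by (simp add: nn_integral_multc integral_abs_normal_product)
  \<comment> \<open>The reflection turns the half line where \<open>r + s * t < 0\<close> into one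
    bounded below, on which the antiderivative \<open>arctan t / pi\<close> can be evaluated from
    \<open>r / s\<close> to infinity.\<close>
  also have "\<dots> = (\<integral>\<^sup>+t. ennreal (1 / (pi * (1 + t\<^sup>2))) * ?K (- t) \<partial>lborel)"
    by (subst nn_integral_real_affine[where c = "-1" and t = 0]) simp_all
  also have "\<dots> = (\<integral>\<^sup>+t. ennreal (1 / (pi * (1 + t\<^sup>2))) * indicator {r / s ..} t \<partial>lborel)"
    using AE_lborel_singleton[of "r / s"] s
    by (intro nn_integral_cong_AE) (auto simp: indicator_def field_simps)
  also have "\<dots> = ennreal (1 / 2 - arctan (r / s) / pi)"
  proof (rule nn_integral_FTC_atLeast)
    show "((\<lambda>t. arctan t / pi) has_real_derivative 1 / (pi * (1 + t\<^sup>2))) (at t)" for t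
    proof -
      have "(arctan has_real_derivative inverse (1 + t\<^sup>2)) (at t)" by (rule DERIV_arctan)
      from DERIV_cdivide[OF this, of pi] show ?thesis by (simp add: divide_inverse mult.commute)
    qed
    have "((\<lambda>t. arctan t / pi) \<longlongrightarrow> (pi / 2) / pi) at_top"
      by (intro tendsto_intros tendsto_arctan_at_top) simp
    then show "((\<lambda>t. arctan t / pi) \<longlongrightarrow> 1 / 2) at_top" by simp
  qed (auto intro!: mult_nonneg_nonneg add_nonneg_nonneg)
  finally show ?thesis .
qed

text \<open>Independence gives the pair the product law, for which the double sector has been
  computed. For \<open>s = sqrt (1 - r\<^sup>2)\<close> the value is \<open>arccos r / pi\<close>,
  because then \<open>arctan (r / s)\<close> is \<open>arcsin r\<close>.\<close>

lemma (in prob_space) prob_sign_change_indep: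
  assumes X: "distributed M lborel X std_normal_density"
    and Z: "distributed M lborel Z std_normal_density"
    and ind: "indep_var borel X borel Z" and s: "s > 0"
  shows "prob {\<omega> \<in> space M. X \<omega> * (r * X \<omega> + s * Z \<omega>) < 0} = 1 / 2 - arctan (r / s) / pi"
proof -
  let ?N = "std_normal_distribution"
  have [measurable]: "X \<in> borel_measurable M" "Z \<in> borel_measurable M"
    using distributed_measurable[OF X] distributed_measurable[OF Z] by simp_all
  have N: "distr M borel X = ?N" "distr M borel Z = ?N"
    using X Z by (simp_all add: distributed_def cong: distr_cong)
  interpret N: prob_space ?N
    by (rule prob_space_normal_density) simp
  let ?S = "{p. fst p * (r * fst p + s * snd p) < 0} :: (real \<times> real) set"
  have "{p \<in> space (borel \<Otimes>\<^sub>M borel). fst p * (r * fst p + s * snd p) < 0} \<in> sets (borel \<Otimes>\<^sub>M borel)"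
    by measurable
  then have S: "?S \<in> sets (?N \<Otimes>\<^sub>M ?N)"
    by (simp add: space_pair_measure cong: sets_pair_measure_cong)
  have "emeasure M {\<omega> \<in> space M. X \<omega> * (r * X \<omega> + s * Z \<omega>) < 0}
      = emeasure (distr M (borel \<Otimes>\<^sub>M borel) (\<lambda>\<omega>. (X \<omega>, Z \<omega>))) ?S"
    using S by (subst emeasure_distr) (auto intro!: arg_cong2[where f = emeasure] cong: sets_pair_measure_cong)
  also have "\<dots> = emeasure (?N \<Otimes>\<^sub>M ?N) ?S"
    using ind unfolding indep_var_distribution_eq by (simp add: N)
  also have "\<dots> = (\<integral>\<^sup>+u. \<integral>\<^sup>+v. indicator ?S (u, v) \<partial>?N \<partial>?N)"
    by (rule N.emeasure_pair_measure[OF S])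
  also have "\<dots> = (\<integral>\<^sup>+u. \<integral>\<^sup>+v. ennreal (std_normal_density u * std_normal_density v)
      * indicator {w. w < 0} (u * (r * u + s * v)) \<partial>lborel \<partial>lborel)"
    by (subst nn_integral_density, simp, simp, intro nn_integral_cong, subst nn_integral_density)
      (auto simp: nn_integral_cmult[symmetric] ennreal_mult mult.assoc indicator_def intro!: nn_integral_cong)
  also have "\<dots> = ennreal (1 / 2 - arctan (r / s) / pi)"
    by (rule normal_double_sector[OF s])
  moreover have "0 \<le> 1 / 2 - arctan (r / s) / pi"
    using arctan_ubound[of "r / s"] by (simp add: field_simps)
  ultimately show ?thesis
    by (simp add: measure_def)
qed

section \<open>Stationary Gaussian processes\<close>

locale normalized_gaussian_process = prob_space M for M :: "'a measure" +
  fixes f :: "real \<Rightarrow> 'a \<Rightarrow> real"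
  assumes gaussian: "gaussian_process M f"
    and centered: "centered_process M f"
    and stationary: "stationary_process M f"
    and normalized: "normalized_process M f"
begin

lemma measurable_process [measurable]: "f x \<in> borel_measurable M"
  using gaussian[unfolded gaussian_process_def, rule_format, of "{x}" "\<lambda>_. 1"]
  by (simp add: gaussian_variable_def)

lemma integrable_process: "integrable M (f x)" and expectation_process: "expectation (f x) = 0"
  using centered by (auto simp: centered_process_def)

text \<open>The index set \<open>{x, y}\<close> carries one coefficient per point, so the two points
  must differ for both coefficients to occur.\<close>

lemma gaussian_variable_linear_combination:
  assumes "x \<noteq> y"
  shows "gaussian_variable M (\<lambda>\<omega>. a * f x \<omega> + b * f y \<omega>)"
  using assms gaussian[unfolded gaussian_process_def, rule_format, of "{x, y}" "\<lambda>z. if z = x then a else b"]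
  by simp

lemma gaussian_variable_process: "gaussian_variable M (f x)"
  using gaussian_variable_linear_combination[of x "x + 1" 1 0] by simp

lemma integrable_square: "integrable M (\<lambda>\<omega>. (f x \<omega>)\<^sup>2)"
  by (intro centered_gaussian_variable gaussian_variable_process expectation_process)

lemma integrable_product: "integrable M (\<lambda>\<omega>. f x \<omega> * f y \<omega>)"
proof (rule Bochner_Integration.integrable_bound)
  show "integrable M (\<lambda>\<omega>. (f x \<omega>)\<^sup>2 + (f y \<omega>)\<^sup>2)"
    by (intro Bochner_Integration.integrable_add integrable_square)
  show "AE \<omega> in M. norm (f x \<omega> * f y \<omega>) \<le> norm ((f x \<omega>)\<^sup>2 + (f y \<omega>)\<^sup>2)"
  proof (rule AE_I2)
    fix \<omega>
    have "0 \<le> (\<bar>f x \<omega>\<bar> - \<bar>f y \<omega>\<bar>)\<^sup>2" "0 \<le> (f x \<omega>)\<^sup>2" "0 \<le> (f y \<omega>)\<^sup>2" by simp_all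
    moreover have "\<bar>f x \<omega>\<bar> * \<bar>f y \<omega>\<bar> \<le> 2 * \<bar>f x \<omega>\<bar> * \<bar>f y \<omega>\<bar>" by simp
    ultimately have "\<bar>f x \<omega>\<bar> * \<bar>f y \<omega>\<bar> \<le> (f x \<omega>)\<^sup>2 + (f y \<omega>)\<^sup>2"
      unfolding power2_diff power2_abs by linarith
    then show "norm (f x \<omega> * f y \<omega>) \<le> norm ((f x \<omega>)\<^sup>2 + (f y \<omega>)\<^sup>2)"
      by (simp add: abs_mult)
  qed
qed simp

text \<open>Stationarity concerns families indexed by a finite set; the pair is read off at the
  indices \<open>0\<close> and \<open>h\<close>. For \<open>h = 0\<close> the index set is a
  singleton and the pair lies on the diagonal, which transports the law of a single value.\<close>

lemma distr_pair_shift: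
  "distr M (borel \<Otimes>\<^sub>M borel) (\<lambda>\<omega>. (f x \<omega>, f (x + h) \<omega>))
    = distr M (borel \<Otimes>\<^sub>M borel) (\<lambda>\<omega>. (f 0 \<omega>, f h \<omega>))"
proof -
  let ?P = "\<Pi>\<^sub>M i\<in>{0, h}. (borel :: real measure)"
  let ?g = "\<lambda>p. (p 0, p h)"
  have [measurable]: "?g \<in> ?P \<rightarrow>\<^sub>M borel \<Otimes>\<^sub>M borel" by measurable
  have eq: "distr M ?P (\<lambda>\<omega>. \<lambda>y\<in>{0, h}. f (y + x) \<omega>) = distr M ?P (\<lambda>\<omega>. \<lambda>y\<in>{0, h}. f y \<omega>)"
    using stationary by (simp add: stationary_process_def)
  have "distr M (borel \<Otimes>\<^sub>M borel) (\<lambda>\<omega>. (f x \<omega>, f (x + h) \<omega>))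
      = distr (distr M ?P (\<lambda>\<omega>. \<lambda>y\<in>{0, h}. f (y + x) \<omega>)) (borel \<Otimes>\<^sub>M borel) ?g"
    by (subst distr_distr) (auto simp: comp_def add.commute)
  also have "\<dots> = distr M (borel \<Otimes>\<^sub>M borel) (\<lambda>\<omega>. (f 0 \<omega>, f h \<omega>))"
    unfolding eq by (subst distr_distr) (auto simp: comp_def)
  finally show ?thesis .
qed

lemma expectation_square: "expectation (\<lambda>\<omega>. (f x \<omega>)\<^sup>2) = 1"
proof -
  have "expectation (\<lambda>\<omega>. (f x \<omega>)\<^sup>2)
      = (\<integral>p. (fst p)\<^sup>2 \<partial>distr M (borel \<Otimes>\<^sub>M borel) (\<lambda>\<omega>. (f x \<omega>, f (x + 0) \<omega>)))"
    by (subst integral_distr) auto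
  also have "\<dots> = expectation (\<lambda>\<omega>. (f 0 \<omega>)\<^sup>2)"
    unfolding distr_pair_shift by (subst integral_distr) auto
  also have "\<dots> = correlation M f 0"
    by (simp add: correlation_def power2_eq_square)
  finally show ?thesis
    using normalized by (simp add: normalized_process_def)
qed

lemma distributed_process: "distributed M lborel (f x) std_normal_density"
  by (intro centered_gaussian_variable gaussian_variable_process expectation_process expectation_square)

lemma expectation_square_linear_combination:
  "expectation (\<lambda>\<omega>. (a * f 0 \<omega> + b * f x \<omega>)\<^sup>2) = a\<^sup>2 + 2 * a * b * correlation M f x + b\<^sup>2"
proof -
  have "expectation (\<lambda>\<omega>. (a * f 0 \<omega> + b * f x \<omega>)\<^sup>2)
    = expectation (\<lambda>\<omega>. a\<^sup>2 * (f 0 \<omega>)\<^sup>2 + (2 * a * b) * (f 0 \<omega> * f x \<omega>) + b\<^sup>2 * (f x \<omega>)\<^sup>2)"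
    by (intro Bochner_Integration.integral_cong) (auto simp: power2_eq_square algebra_simps)
  also have "\<dots> = a\<^sup>2 + 2 * a * b * correlation M f x + b\<^sup>2"
    using integrable_square integrable_product
    by (simp add: expectation_square correlation_def)
  finally show ?thesis .
qed

text \<open>The mean squares of \<open>f x + f 0\<close> and \<open>f x - f 0\<close> are
  nonnegative. The bound makes \<open>0\<close> a maximum of the correlation, so that its derivative
  vanishes there.\<close>

lemma abs_correlation_le: "\<bar>correlation M f x\<bar> \<le> 1"
proof -
  have "0 \<le> a\<^sup>2 + 2 * a * 1 * correlation M f x + 1\<^sup>2" for a
    unfolding expectation_square_linear_combination[symmetric] by (intro integral_nonneg_AE) simp
  from this[of 1] this[of "-1"] show ?thesis by simp
qed

text \<open>The standard normal density is at most 1. What matters is the linear rate in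
  \<open>\<epsilon>\<close>, which balances the growing number of grid points in the proof that
  there are no double zeros.\<close>

lemma prob_abs_le:
  assumes "0 \<le> \<epsilon>"
  shows "prob {\<omega> \<in> space M. \<bar>f x \<omega>\<bar> \<le> \<epsilon>} \<le> 2 * \<epsilon>"
proof -
  have le1: "std_normal_density u \<le> 1" for u
  proof -
    have "1 \<le> sqrt (2 * pi)" using pi_gt3 by simp
    then have "1 / sqrt (2 * pi) * exp (- u\<^sup>2 / 2) \<le> 1 * 1"
      by (intro mult_mono) auto
    then show ?thesis by (simp add: std_normal_density_def)
  qed
  have "emeasure M {\<omega> \<in> space M. \<bar>f x \<omega>\<bar> \<le> \<epsilon>} = (\<integral>\<^sup>+\<omega>. indicator {-\<epsilon>..\<epsilon>} (f x \<omega>) \<partial>M)"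
    by (simp flip: nn_integral_indicator)
      (auto intro!: nn_integral_cong simp: indicator_def)
  also have "\<dots> = (\<integral>\<^sup>+u. ennreal (std_normal_density u) * indicator {-\<epsilon>..\<epsilon>} u \<partial>lborel)"
    by (rule distributed_nn_integral[OF distributed_process, symmetric]) simp
  also have "\<dots> \<le> (\<integral>\<^sup>+u. indicator {-\<epsilon>..\<epsilon>} u \<partial>lborel)"
    using le1 by (intro nn_integral_mono) (auto simp: indicator_def)
  also have "\<dots> = ennreal (2 * \<epsilon>)" using assms by simp
  finally show ?thesis
    using assms by (simp add: emeasure_eq_measure)
qed

lemma AE_nonzero: "AE \<omega> in M. f x \<omega> \<noteq> 0"
proof -
  have "prob {\<omega> \<in> space M. \<bar>f x \<omega>\<bar> \<le> 0} = 0"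
    using prob_abs_le[of 0 x] by (simp add: measure_le_0_iff)
  then have "emeasure M {\<omega> \<in> space M. \<bar>f x \<omega>\<bar> \<le> 0} = 0"
    by (simp add: emeasure_eq_measure)
  then show ?thesis
    by (intro AE_I[where N = "{\<omega> \<in> space M. \<bar>f x \<omega>\<bar> \<le> 0}"]) auto
qed

lemma prob_sign_change_shift:
  "prob {\<omega> \<in> space M. f x \<omega> * f (x + h) \<omega> < 0} = prob {\<omega> \<in> space M. f 0 \<omega> * f h \<omega> < 0}"
proof -
  let ?S = "{p \<in> space (borel \<Otimes>\<^sub>M borel). fst p * snd p < (0::real)}"
  have S: "?S \<in> sets (borel \<Otimes>\<^sub>M borel)"
    by measurable
  have "prob {\<omega> \<in> space M. f x \<omega> * f (x + h) \<omega> < 0}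
      = measure (distr M (borel \<Otimes>\<^sub>M borel) (\<lambda>\<omega>. (f x \<omega>, f (x + h) \<omega>))) ?S" for x
    by (subst measure_distr[OF _ S]) (auto intro!: arg_cong[where f = prob] simp: space_pair_measure)
  from this[of x] this[of 0] show ?thesis
    by (simp add: distr_pair_shift)
qed

text \<open>Sheppard's formula: \<open>f h\<close> is a combination of \<open>f 0\<close> and of a standard normal variable that is
  uncorrelated with it, hence independent of it.\<close>

lemma prob_sign_change:
  assumes "\<bar>correlation M f h\<bar> < 1"
  shows "prob {\<omega> \<in> space M. f 0 \<omega> * f h \<omega> < 0}
    = 1 / 2 - arctan (correlation M f h / sqrt (1 - (correlation M f h)\<^sup>2)) / pi"
proof -
  define r where "r = correlation M f h"
  define s where "s = sqrt (1 - r\<^sup>2)"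
  have "r\<^sup>2 < 1" using assms by (simp add: r_def abs_square_less_1)
  then have s: "s > 0" "s\<^sup>2 = 1 - r\<^sup>2" by (simp_all add: s_def)
  have "h \<noteq> 0" using assms normalized by (auto simp: normalized_process_def)
  define Z where "Z \<omega> = (f h \<omega> - r * f 0 \<omega>) / s" for \<omega>
  have [measurable]: "Z \<in> borel_measurable M" unfolding Z_def[abs_def] by simp
  have comb: "a * f 0 \<omega> + b * Z \<omega> = (a - b * r / s) * f 0 \<omega> + (b / s) * f h \<omega>" for a b \<omega>
    using s(1) by (simp add: Z_def field_simps)
  have gauss: "gaussian_variable M (\<lambda>\<omega>. a * f 0 \<omega> + b * Z \<omega>)" for a b
    unfolding comb using \<open>h \<noteq> 0\<close> by (intro gaussian_variable_linear_combination) simp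
  have mean: "expectation (\<lambda>\<omega>. a * f 0 \<omega> + b * Z \<omega>) = 0" for a b
    unfolding comb using integrable_process expectation_process by simp
  \<comment> \<open>\<open>f 0\<close> and \<open>Z\<close> are orthonormal in mean square. The
    characteristic function depends on the mean square only, and the sum
    \<open>a\<^sup>2 + b\<^sup>2\<close> makes it factor.\<close>
  have sq: "expectation (\<lambda>\<omega>. (a * f 0 \<omega> + b * Z \<omega>)\<^sup>2) = a\<^sup>2 + b\<^sup>2" for a b
  proof -
    have "expectation (\<lambda>\<omega>. (a * f 0 \<omega> + b * Z \<omega>)\<^sup>2)
        = (a - b * r / s)\<^sup>2 + 2 * (a - b * r / s) * (b / s) * r + (b / s)\<^sup>2"
      unfolding comb r_def by (rule expectation_square_linear_combination)
    also have "\<dots> = a\<^sup>2 + b\<^sup>2 * ((1 - r\<^sup>2) / s\<^sup>2)"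
      using s(1) by (simp add: field_simps power2_eq_square)
    also have "\<dots> = a\<^sup>2 + b\<^sup>2"
      unfolding s(2)[symmetric] using s(1) by simp
    finally show ?thesis .
  qed
  have char: "(CLINT \<omega>|M. iexp (a * f 0 \<omega> + b * Z \<omega>)) = exp (- (a\<^sup>2 + b\<^sup>2) / 2)" for a b
    using centered_gaussian_variable(2)[OF gauss mean] by (simp add: sq)
  have char0: "(CLINT \<omega>|M. iexp (a * f 0 \<omega>)) = exp (- (a\<^sup>2) / 2)"
    "(CLINT \<omega>|M. iexp (a * Z \<omega>)) = exp (- (a\<^sup>2) / 2)" for a
    using char[of a 0] char[of 0 a] by simp_all
  have "indep_var borel (f 0) borel Z"
  proof (rule indep_var_char)
    show "(CLINT \<omega>|M. iexp (a * f 0 \<omega> + b * Z \<omega>))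
      = (CLINT \<omega>|M. iexp (a * f 0 \<omega>)) * (CLINT \<omega>|M. iexp (b * Z \<omega>))" for a b
      unfolding char char0 by (simp add: exp_add[symmetric] diff_divide_distrib flip: of_real_mult)
  qed auto
  moreover have "distributed M lborel Z std_normal_density"
    using centered_gaussian_variable(3)[OF gauss mean, of 0 1] sq[of 0 1] by simp
  ultimately have "prob {\<omega> \<in> space M. f 0 \<omega> * (r * f 0 \<omega> + s * Z \<omega>) < 0} = 1 / 2 - arctan (r / s) / pi"
    using distributed_process s(1) by (intro prob_sign_change_indep)
  moreover have "r * f 0 \<omega> + s * Z \<omega> = f h \<omega>" for \<omega>
    using s(1) by (simp add: Z_def)
  ultimately show ?thesis by (simp add: r_def s_def)
qed

section \<open>Small lags: the correlation and the probability of a sign change\<close>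

lemma correlation_second_order:
  "((\<lambda>h. (1 - correlation M f h) / h\<^sup>2) \<longlongrightarrow> 1 / 2) (at_right 0)"
proof -
  let ?\<kappa> = "correlation M f"
  have k0: "?\<kappa> 0 = 1" and ev: "\<forall>\<^sub>F x in nhds 0. ?\<kappa> field_differentiable at x"
    and k2: "(deriv ?\<kappa> has_real_derivative - 1) (at 0)"
    using normalized by (auto simp: normalized_process_def)
  have D: "(?\<kappa> has_real_derivative deriv ?\<kappa> x) (at x)" if "?\<kappa> field_differentiable at x" for x
    using that by (simp add: DERIV_deriv_iff_field_differentiable)
  have D0: "(?\<kappa> has_real_derivative deriv ?\<kappa> 0) (at 0)"
    using eventually_nhds_x_imp_x[OF ev] by (rule D)
  \<comment> \<open>As \<open>0\<close> is a maximum, the first derivative vanishes there, and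
    \<open>deriv ?\<kappa> h / h\<close> becomes the difference quotient that defines the second
    derivative.\<close>
  have "deriv ?\<kappa> 0 = 0"
    using D0 by (rule DERIV_local_max[of _ _ _ 1]) (use abs_correlation_le in \<open>auto simp: k0 abs_le_iff\<close>)
  then have lim: "((\<lambda>h. deriv ?\<kappa> h / h) \<longlongrightarrow> - 1) (at 0)"
    using k2 by (simp add: has_field_derivative_iff)
  have evr: "\<forall>\<^sub>F x in at_right 0. ?\<kappa> field_differentiable at x"
    using ev unfolding eventually_at_filter by (rule eventually_mono) simp
  show ?thesis
  \<comment> \<open>The second derivative is given at \<open>0\<close> only, so the rule is applied
    once; the quotient that remains is the difference quotient just obtained.\<close>
  proof (rule lhopital_right_0)
    have "(?\<kappa> \<longlongrightarrow> 1) (at_right 0)"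
      using DERIV_isCont[OF D0] k0 unfolding isCont_def by (auto intro: tendsto_mono at_le)
    then have "((\<lambda>h. 1 - ?\<kappa> h) \<longlongrightarrow> 1 - 1) (at_right 0)" by (intro tendsto_intros)
    then show "((\<lambda>h. 1 - ?\<kappa> h) \<longlongrightarrow> 0) (at_right 0)" by simp
    have "((\<lambda>h::real. h\<^sup>2) \<longlongrightarrow> 0\<^sup>2) (at_right 0)" by (intro tendsto_intros)
    then show "((\<lambda>h::real. h\<^sup>2) \<longlongrightarrow> 0) (at_right 0)" by simp
    show "\<forall>\<^sub>F h in at_right 0. h\<^sup>2 \<noteq> (0::real)" "\<forall>\<^sub>F h in at_right 0. 2 * h \<noteq> (0::real)"
      by (auto simp: eventually_at_filter)
    show "\<forall>\<^sub>F h in at_right 0. ((\<lambda>h. 1 - ?\<kappa> h) has_real_derivative - deriv ?\<kappa> h) (at h)"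
      using evr by eventually_elim (auto intro!: derivative_eq_intros D)
    show "\<forall>\<^sub>F h in at_right 0. ((\<lambda>h. h\<^sup>2) has_real_derivative 2 * h) (at h)"
      by (auto intro!: always_eventually derivative_eq_intros)
    have "((\<lambda>h. (- 1 / 2) * (deriv ?\<kappa> h / h)) \<longlongrightarrow> (- 1 / 2) * - 1) (at_right 0)"
      using lim by (intro tendsto_intros) (auto intro: tendsto_mono at_le)
    then show "((\<lambda>h. - deriv ?\<kappa> h / (2 * h)) \<longlongrightarrow> 1 / 2) (at_right 0)" by simp
  qed
qed

text \<open>With \<open>s = sqrt (1 - \<kappa>\<^sup>2)\<close> and \<open>h\<close> small and
  positive, \<open>\<kappa>\<close> and \<open>s\<close> are positive and
  \<open>pi / 2 - arctan (\<kappa> / s)\<close> equals \<open>arctan (s / \<kappa>)\<close>. The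
  cancellation in Sheppard's formula disappears, and what remains is that
  \<open>s / \<kappa>\<close> is equivalent to \<open>h\<close>.\<close>

lemma prob_sign_change_asymp:
  "((\<lambda>h. prob {\<omega> \<in> space M. f 0 \<omega> * f h \<omega> < 0} / h) \<longlongrightarrow> 1 / pi) (at_right 0)"
proof -
  let ?\<kappa> = "correlation M f"
  let ?s = "\<lambda>h. sqrt (1 - (?\<kappa> h)\<^sup>2)"
  have pos: "\<forall>\<^sub>F h in at_right 0. (0::real) < h" by (simp add: eventually_at_filter)
  \<comment> \<open>The right limit of the correlation at \<open>0\<close> is recovered from its
    second-order limit, by multiplying back with \<open>h\<^sup>2\<close>.\<close>
  have "((\<lambda>h. 1 - (1 - ?\<kappa> h) / h\<^sup>2 * h\<^sup>2) \<longlongrightarrow> 1 - 1 / 2 * 0\<^sup>2) (at_right 0)"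
    by (intro tendsto_intros correlation_second_order)
  moreover have "\<forall>\<^sub>F h in at_right 0. 1 - (1 - ?\<kappa> h) / h\<^sup>2 * h\<^sup>2 = ?\<kappa> h"
    using pos by eventually_elim simp
  ultimately have k: "(?\<kappa> \<longlongrightarrow> 1) (at_right 0)"
    by (simp cong: filterlim_cong)
  \<comment> \<open>\<open>1 - \<kappa>\<^sup>2\<close> is the product of
    \<open>1 - \<kappa>\<close>, which is equivalent to \<open>h\<^sup>2 / 2\<close>, and
    \<open>1 + \<kappa>\<close>, which tends to 2.\<close>
  have "((\<lambda>h. sqrt ((1 - ?\<kappa> h) / h\<^sup>2 * (1 + ?\<kappa> h))) \<longlongrightarrow> sqrt (1 / 2 * (1 + 1))) (at_right 0)"
    by (intro tendsto_intros correlation_second_order k)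
  moreover have "\<forall>\<^sub>F h in at_right 0. sqrt ((1 - ?\<kappa> h) / h\<^sup>2 * (1 + ?\<kappa> h)) = ?s h / h"
    using pos
  proof eventually_elim
    case (elim h)
    have "(1 - ?\<kappa> h) / h\<^sup>2 * (1 + ?\<kappa> h) = (1 - (?\<kappa> h)\<^sup>2) / h\<^sup>2"
      by (simp add: power2_eq_square algebra_simps)
    with elim show ?case by (simp add: real_sqrt_divide)
  qed
  ultimately have sh: "((\<lambda>h. ?s h / h) \<longlongrightarrow> 1) (at_right 0)"
    by (simp cong: filterlim_cong)
  have "((\<lambda>h. ?s h / h * h / ?\<kappa> h) \<longlongrightarrow> 1 * 0 / 1) (at_right 0)"
    by (intro tendsto_intros sh k) simp
  then have y: "((\<lambda>h. ?s h / h * h / ?\<kappa> h) \<longlongrightarrow> 0) (at_right 0)" by simp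
  have evs: "\<forall>\<^sub>F h in at_right 0. 0 < ?s h / h" "\<forall>\<^sub>F h in at_right 0. 0 < ?\<kappa> h"
    using order_tendstoD(1)[OF sh, of 0] order_tendstoD(1)[OF k, of 0] by simp_all
  \<comment> \<open>The limit of \<open>arctan y / y\<close> is that of a difference quotient and
    concerns \<open>y \<noteq> 0\<close>, so the argument has to tend to 0 without reaching
    it.\<close>
  have at: "filterlim (\<lambda>h. ?s h / h * h / ?\<kappa> h) (at 0) (at_right 0)"
    unfolding filterlim_at
  proof
    show "\<forall>\<^sub>F h in at_right 0. ?s h / h * h / ?\<kappa> h \<in> UNIV \<and> ?s h / h * h / ?\<kappa> h \<noteq> 0"
      using evs pos by eventually_elim (auto simp: zero_less_divide_iff)
  qed (rule y)
  have "((\<lambda>y. (arctan (0 + y) - arctan 0) / y) \<longlongrightarrow> inverse (1 + 0\<^sup>2)) (at (0::real))"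
    using DERIV_arctan[of 0] unfolding DERIV_def .
  then have "((\<lambda>y. arctan y / y) \<longlongrightarrow> 1) (at (0::real))" by simp
  from filterlim_compose[OF this at]
  have "((\<lambda>h. arctan (?s h / h * h / ?\<kappa> h) / (?s h / h * h / ?\<kappa> h) * (?s h / h) / ?\<kappa> h / pi) \<longlongrightarrow> 1 * 1 / 1 / pi) (at_right 0)"
    by (intro tendsto_intros sh k) auto
  moreover have "\<forall>\<^sub>F h in at_right 0. arctan (?s h / h * h / ?\<kappa> h) / (?s h / h * h / ?\<kappa> h) * (?s h / h) / ?\<kappa> h / pi
      = prob {\<omega> \<in> space M. f 0 \<omega> * f h \<omega> < 0} / h"
    using evs pos
  proof eventually_elim
    case (elim h)
    then have s: "?s h > 0" by (simp add: zero_less_divide_iff)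
    then have "\<bar>?\<kappa> h\<bar> < 1" by (simp add: abs_square_less_1)
    then have "prob {\<omega> \<in> space M. f 0 \<omega> * f h \<omega> < 0} = 1 / 2 - arctan (?\<kappa> h / ?s h) / pi"
      by (rule prob_sign_change)
    also have "arctan (?\<kappa> h / ?s h) = pi / 2 - arctan (?s h / ?\<kappa> h)"
      using arctan_inverse[of "?s h / ?\<kappa> h"] s elim by simp
    finally have "prob {\<omega> \<in> space M. f 0 \<omega> * f h \<omega> < 0} = arctan (?s h / ?\<kappa> h) / pi"
      by (simp add: diff_divide_distrib)
    then show ?case using elim s by simp
  qed
  ultimately show ?thesis by (simp cong: filterlim_cong)
qed

end

section \<open>Counting simple zeros by sign changes\<close>

text \<open>The sign of \<open>D\<close> fixes the sign of \<open>F\<close> on either side of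
  \<open>z\<close>; \<open>F\<close> need not be monotone there. As the products never vanish,
  \<open>z\<close> is also the only zero at distance less than \<open>d\<close>, and isolation of
  zeros is used in this form.\<close>

lemma sign_change_at_simple_zero:
  fixes F :: "real \<Rightarrow> real"
  assumes D: "(F has_real_derivative D) (at z)" and "D \<noteq> 0" "F z = 0"
  obtains d where "d > 0" "\<And>x y. z - d < x \<Longrightarrow> x < z \<Longrightarrow> z < y \<Longrightarrow> y < z + d \<Longrightarrow> F x * F y < 0"
proof (cases "D > 0")
  case True
  obtain d1 where d1: "d1 > 0" "\<And>h. 0 < h \<Longrightarrow> h < d1 \<Longrightarrow> F z < F (z + h)"
    using DERIV_pos_inc_right[OF D True] by blast
  obtain d2 where d2: "d2 > 0" "\<And>h. 0 < h \<Longrightarrow> h < d2 \<Longrightarrow> F (z - h) < F z"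
    using DERIV_pos_inc_left[OF D True] by blast
  show thesis
  proof (rule that[of "min d1 d2"])
    fix x y assume "z - min d1 d2 < x" "x < z" "z < y" "y < z + min d1 d2"
    then show "F x * F y < 0"
      using d1(2)[of "y - z"] d2(2)[of "z - x"] \<open>F z = 0\<close> by (intro mult_neg_pos) auto
  qed (use d1 d2 in auto)
next
  case False
  then have "D < 0" using \<open>D \<noteq> 0\<close> by simp
  obtain d1 where d1: "d1 > 0" "\<And>h. 0 < h \<Longrightarrow> h < d1 \<Longrightarrow> F (z + h) < F z"
    using DERIV_neg_dec_right[OF D \<open>D < 0\<close>] by blast
  obtain d2 where d2: "d2 > 0" "\<And>h. 0 < h \<Longrightarrow> h < d2 \<Longrightarrow> F z < F (z - h)"
    using DERIV_neg_dec_left[OF D \<open>D < 0\<close>] by blast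
  show thesis
  proof (rule that[of "min d1 d2"])
    fix x y assume "z - min d1 d2 < x" "x < z" "z < y" "y < z + min d1 d2"
    then show "F x * F y < 0"
      using d1(2)[of "y - z"] d2(2)[of "z - x"] \<open>F z = 0\<close> by (intro mult_pos_neg) auto
  qed (use d1 d2 in auto)
qed

text \<open>A second zero close to \<open>z\<close> would make one of the negative products around
  \<open>z\<close> vanish. Hence zeros do not accumulate, and a compact set has only finitely many
  of them.\<close>

lemma finite_simple_zeros:
  fixes F :: "real \<Rightarrow> real"
  assumes cont: "continuous_on UNIV F"
    and simple: "\<And>z. F z = 0 \<Longrightarrow> \<exists>D. D \<noteq> 0 \<and> (F has_real_derivative D) (at z)"
  shows "finite {x \<in> {a..b}. F x = 0}"
proof -
  have "closed {x. F x = 0}"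
    using closed_Collect_eq[OF cont continuous_on_const[of _ 0]] by simp
  then have "compact ({a..b} \<inter> {x. F x = 0})"
    by (intro compact_Int_closed) auto
  moreover have "\<not> z islimpt {x. F x = 0}" if z: "z \<in> {a..b} \<inter> {x. F x = 0}" for z
  proof
    assume "z islimpt {x. F x = 0}"
    obtain D where D: "D \<noteq> 0" "(F has_real_derivative D) (at z)" using simple[of z] z by auto
    obtain d where d: "d > 0"
      "\<And>x y. z - d < x \<Longrightarrow> x < z \<Longrightarrow> z < y \<Longrightarrow> y < z + d \<Longrightarrow> F x * F y < 0"
      by (rule sign_change_at_simple_zero[OF D(2,1)]) (use z in auto)
    obtain w where w: "F w = 0" "w \<noteq> z" "\<bar>w - z\<bar> < d"
      using \<open>z islimpt {x. F x = 0}\<close> d(1) by (auto simp: islimpt_approachable dist_real_def)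
    show False
      using d(2)[of w "z + d / 2"] d(2)[of "z - d / 2" w] w d(1) by (cases "w < z") auto
  qed
  ultimately have "finite ({a..b} \<inter> {x. F x = 0} \<inter> {x. F x = 0})"
    by (intro finite_not_islimpt_in_compact)
  then show ?thesis by (rule rev_finite_subset) auto
qed

text \<open>The index \<open>k\<close> is not bounded by \<open>n\<close>. For \<open>n = 0\<close>,
  division by zero makes every point equal to \<open>a\<close>, so \<open>grid_Suc\<close> holds
  there as well.\<close>

definition grid :: "real \<Rightarrow> real \<Rightarrow> nat \<Rightarrow> nat \<Rightarrow> real" where
  "grid a b n k = a + (b - a) * real k / real n"

definition sign_changes :: "(real \<Rightarrow> real) \<Rightarrow> real \<Rightarrow> real \<Rightarrow> nat \<Rightarrow> nat set" where
  "sign_changes F a b n = {k. k < n \<and> F (grid a b n k) * F (grid a b n (Suc k)) < 0}"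

lemma grid_Suc: "grid a b n (Suc k) = grid a b n k + (b - a) / real n"
  by (simp add: grid_def distrib_left add_divide_distrib)

lemma grid_mono: "a \<le> b \<Longrightarrow> k \<le> l \<Longrightarrow> grid a b n k \<le> grid a b n l"
  by (simp add: grid_def divide_right_mono mult_left_mono)

text \<open>A sign change forces a zero strictly inside its cell by the intermediate value theorem.
  Cells with different indices meet at most in an endpoint, so the chosen zeros increase strictly
  with the index.\<close>

lemma card_sign_changes_le:
  fixes F :: "real \<Rightarrow> real"
  assumes cont: "continuous_on UNIV F" and fin: "finite {x \<in> {a..b}. F x = 0}" and ab: "a < b"
  shows "card (sign_changes F a b n) \<le> card {x \<in> {a..b}. F x = 0}"
proof -
  have "\<exists>z. grid a b n k < z \<and> z < grid a b n (Suc k) \<and> F z = 0" if k: "k \<in> sign_changes F a b n" for k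
  proof -
    let ?x = "grid a b n k" and ?y = "grid a b n (Suc k)"
    have neg: "F ?x * F ?y < 0" using k by (simp add: sign_changes_def)
    have "?x \<le> ?y" using ab by (intro grid_mono) auto
    moreover have "F ?x \<le> 0 \<and> 0 \<le> F ?y \<or> F ?y \<le> 0 \<and> 0 \<le> F ?x"
      using neg by (auto simp: mult_less_0_iff)
    ultimately obtain z where "?x \<le> z" "z \<le> ?y" "F z = 0"
      using IVT'[of F ?x 0 ?y] IVT2'[of F ?y 0 ?x] continuous_on_subset[OF cont] by blast
    moreover have "z \<noteq> ?x" "z \<noteq> ?y" using neg \<open>F z = 0\<close> by auto
    ultimately show ?thesis by (intro exI[of _ z]) auto
  qed
  then obtain g where g: "\<And>k. k \<in> sign_changes F a b n \<Longrightarrow>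
      grid a b n k < g k \<and> g k < grid a b n (Suc k) \<and> F (g k) = 0"
    by metis
  show ?thesis
  proof (rule card_inj_on_le[of g])
    have "g k < g l" if "k \<in> sign_changes F a b n" "l \<in> sign_changes F a b n" "k < l" for k l
    proof -
      have "g k < grid a b n (Suc k)" "grid a b n l < g l" using g that by auto
      moreover have "grid a b n (Suc k) \<le> grid a b n l" using ab that by (intro grid_mono) auto
      ultimately show ?thesis by linarith
    qed
    then show "inj_on g (sign_changes F a b n)"
      by (metis inj_onI less_irrefl linorder_neqE_nat)
    show "g ` sign_changes F a b n \<subseteq> {x \<in> {a..b}. F x = 0}"
    proof safe
      fix k assume k: "k \<in> sign_changes F a b n"
      then have "k < n" by (simp add: sign_changes_def)
      then have "grid a b n 0 \<le> grid a b n k" "grid a b n (Suc k) \<le> grid a b n n"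
        using ab by (auto intro!: grid_mono)
      moreover have "grid a b n 0 = a" "grid a b n n = b" using \<open>k < n\<close> by (auto simp: grid_def)
      ultimately show "g k \<in> {a..b}" "F (g k) = 0" using g[OF k] by auto
    qed
  qed (rule fin)
qed

lemma obtain_grid_cell:
  assumes "a \<le> z" "z \<le> b" "a < b" "n > 0" and off: "\<And>k. z \<noteq> grid a b n k"
  obtains k where "k < n" "grid a b n k < z" "z < grid a b n (Suc k)"
proof -
  \<comment> \<open>\<open>t\<close> is the position of \<open>z\<close> in units of the mesh. The
    index \<open>k = n\<close> does not occur, because \<open>b\<close> is a grid point and
    \<open>z\<close> is not.\<close>
  define t where "t = (z - a) * real n / (b - a)"
  define k where "k = nat \<lfloor>t\<rfloor>"
  have t: "0 \<le> t" "z = a + (b - a) * t / real n"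
    using assms by (auto simp: t_def)
  have k: "real k \<le> t" "t < real (Suc k)"
    using t(1) by (simp_all add: k_def) linarith
  have c: "0 < (b - a) / real n" using assms by simp
  have "grid a b n k = a + (b - a) / real n * real k" "grid a b n (Suc k) = a + (b - a) / real n * real (Suc k)"
    "z = a + (b - a) / real n * t"
    unfolding t(2) by (simp_all add: grid_def)
  then have "grid a b n k \<le> z" "z < grid a b n (Suc k)"
    using mult_left_mono[OF k(1), of "(b - a) / real n"] mult_strict_left_mono[OF k(2) c] c by simp_all
  moreover have "grid a b n k \<noteq> z" using off by metis
  ultimately have cell: "grid a b n k < z" "z < grid a b n (Suc k)" by auto
  have "k < n"
  proof (rule ccontr)
    assume "\<not> k < n"
    then have "grid a b n n \<le> grid a b n k" using assms by (intro grid_mono) auto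
    then show False using cell assms by (simp add: grid_def)
  qed
  with cell that show thesis by blast
qed

text \<open>The inequality opposite to \<open>card_sign_changes_le\<close> holds as soon as the mesh
  is below the isolation radius of each of the finitely many zeros: a cell around a zero then shows
  a sign change and contains no other zero. The hypothesis \<open>off\<close> puts every zero in the
  interior of a cell.\<close>

lemma eventually_card_sign_changes:
  fixes F :: "real \<Rightarrow> real"
  assumes cont: "continuous_on UNIV F"
    and simple: "\<And>z. F z = 0 \<Longrightarrow> \<exists>D. D \<noteq> 0 \<and> (F has_real_derivative D) (at z)"
    and ab: "a < b" and off: "\<And>n k. F (grid a b n k) \<noteq> 0"
  shows "\<forall>\<^sub>F n in sequentially. card (sign_changes F a b n) = card {x \<in> {a..b}. F x = 0}"
proof -
  let ?Z = "{x \<in> {a..b}. F x = 0}"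
  have fin: "finite ?Z" by (rule finite_simple_zeros[OF cont simple])
  have "\<exists>d>0. \<forall>x y. z - d < x \<longrightarrow> x < z \<longrightarrow> z < y \<longrightarrow> y < z + d \<longrightarrow> F x * F y < 0" if z: "F z = 0" for z
  proof -
    obtain D where "D \<noteq> 0" "(F has_real_derivative D) (at z)" using simple[OF z] by blast
    then obtain d where "d > 0" "\<And>x y. z - d < x \<Longrightarrow> x < z \<Longrightarrow> z < y \<Longrightarrow> y < z + d \<Longrightarrow> F x * F y < 0"
      using sign_change_at_simple_zero[of F D z] z by auto
    then show ?thesis by blast
  qed
  then obtain d where d: "\<And>z. F z = 0 \<Longrightarrow> d z > 0"
    "\<And>z x y. F z = 0 \<Longrightarrow> z - d z < x \<Longrightarrow> x < z \<Longrightarrow> z < y \<Longrightarrow> y < z + d z \<Longrightarrow> F x * F y < 0"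
    by metis
  have "(\<lambda>n. (b - a) / real n) \<longlonglongrightarrow> 0"
    by (rule tendsto_divide_0[OF tendsto_const filterlim_at_top_imp_at_infinity[OF filterlim_real_sequentially]])
  then have "\<forall>\<^sub>F n in sequentially. (b - a) / real n < d z" if "F z = 0" for z
    using d(1)[OF that] by (rule order_tendstoD)
  then have "\<forall>\<^sub>F n in sequentially. \<forall>z\<in>?Z. (b - a) / real n < d z"
    using fin by (intro eventually_ball_finite) auto
  moreover have "\<forall>\<^sub>F n in sequentially. n > (0::nat)" by (rule eventually_gt_at_top)
  ultimately show ?thesis
  proof eventually_elim
    case (elim n)
    have "\<exists>k. k < n \<and> grid a b n k < z \<and> z < grid a b n (Suc k)" if "z \<in> ?Z" for z
      using obtain_grid_cell[of a z b n] that ab \<open>n > 0\<close> off by (metis (mono_tags, lifting) atLeastAtMost_iff mem_Collect_eq)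
    then obtain c where c: "\<And>z. z \<in> ?Z \<Longrightarrow> c z < n \<and> grid a b n (c z) < z \<and> z < grid a b n (Suc (c z))"
      by metis
    have "card ?Z \<le> card (sign_changes F a b n)"
    proof (rule card_inj_on_le[of c])
      show "c ` ?Z \<subseteq> sign_changes F a b n"
      proof
        fix k assume "k \<in> c ` ?Z"
        then obtain z where z: "z \<in> ?Z" "k = c z" by blast
        then have "F (grid a b n k) * F (grid a b n (Suc k)) < 0"
          using c[OF z(1)] elim(1) grid_Suc[of a b n k] by (intro d(2)[of z]) force+
        then show "k \<in> sign_changes F a b n" using c[OF z(1)] z(2) by (simp add: sign_changes_def)
      qed
      have "\<not> z < w" if z: "z \<in> ?Z" and w: "w \<in> ?Z" and "c z = c w" for z w
      proof
        assume "z < w"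
        have "w < z + d z"
          using c[OF z] c[OF w] \<open>c z = c w\<close> grid_Suc[of a b n "c z"] elim(1) z by force
        \<comment> \<open>If \<open>z\<close> and \<open>w\<close> shared a cell, \<open>w\<close>
          would lie within the radius of \<open>z\<close>; any point just left of \<open>z\<close>,
          paired with \<open>w\<close>, gives the contradiction.\<close>
        then have "F (z - d z / 2) * F w < 0"
          using \<open>z < w\<close> z d(1)[of z] by (intro d(2)[of z]) auto
        then show False using w by simp
      qed
      then show "inj_on c ?Z" by (metis (no_types, lifting) inj_onI linorder_neqE_linordered_idom)
      show "finite (sign_changes F a b n)" by (simp add: sign_changes_def)
    qed
    with card_sign_changes_le[OF cont fin ab] show ?case by (rule antisym)
  qed
qed

section \<open>Random measures whose intensity is a multiple of Lebesgue measure\<close>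

text \<open>Completeness absorbs the difference of the two preimages. The number of zeros and the
  integrals against the zero measure are known almost surely only, and they obtain their
  measurability in this way.\<close>

lemma (in complete_measure) measurable_AE_eq:
  assumes f: "f \<in> M \<rightarrow>\<^sub>M N" and eq: "AE x in M. f x = g x" and sp: "\<And>x. x \<in> space M \<Longrightarrow> g x \<in> space N"
  shows "g \<in> M \<rightarrow>\<^sub>M N"
proof (rule measurableI)
  fix A assume A: "A \<in> sets N"
  show "g -` A \<inter> space M \<in> sets M"
  proof (rule in_sets_AE)
    show "AE x in M. x \<in> f -` A \<inter> space M \<longleftrightarrow> x \<in> g -` A \<inter> space M"
      using eq by eventually_elim auto
  qed (use f A in \<open>auto intro: measurable_sets\<close>)
qed (rule sp)

lemma Int_stable_atLeastAtMost: "Int_stable (range (\<lambda>(a, b). {a..b::real}))"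
proof (rule Int_stableI)
  fix A B :: "real set"
  assume "A \<in> range (\<lambda>(a, b). {a..b})" "B \<in> range (\<lambda>(a, b). {a..b})"
  then obtain a b c d where "A = {a..b}" "B = {c..d}" by auto
  then have "A \<inter> B = (\<lambda>(a, b). {a..b}) (max a c, min b d)" by auto
  then show "A \<inter> B \<in> range (\<lambda>(a, b). {a..b})" by blast
qed

lemma sets_borel_eq_atLeastAtMost: "sets (borel :: real measure) = sigma_sets UNIV (range (\<lambda>(a, b). {a..b}))"
  unfolding borel_eq_atLeastAtMost by simp

text \<open>\<open>N\<close> is not assumed to be a measurable kernel, so a Dynkin argument from
  intervals proves measurability of the mass together with its mean. Complements require a
  subtraction, hence the restriction to a window \<open>{- real m..real m}\<close> of finite mean
  mass.\<close>

lemma (in complete_measure) intensity_eq_lborel_sets: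
  fixes N :: "'a \<Rightarrow> real measure"
  assumes sets_N [measurable_cong]: "\<And>\<omega>. sets (N \<omega>) = sets borel" and c: "0 \<le> c"
    and meas: "\<And>a b. a \<le> b \<Longrightarrow> (\<lambda>\<omega>. emeasure (N \<omega>) {a..b}) \<in> borel_measurable M"
    and int: "\<And>a b. a \<le> b \<Longrightarrow> (\<integral>\<^sup>+\<omega>. emeasure (N \<omega>) {a..b} \<partial>M) = ennreal (c * (b - a))"
    and A: "A \<in> sets borel"
  shows "(\<lambda>\<omega>. emeasure (N \<omega>) A) \<in> borel_measurable M"
    and "(\<integral>\<^sup>+\<omega>. emeasure (N \<omega>) A \<partial>M) = ennreal c * emeasure lborel A"
proof -
  have trunc: "(\<lambda>\<omega>. emeasure (N \<omega>) (B \<inter> {- real m..real m})) \<in> borel_measurable M \<and>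
    (\<integral>\<^sup>+\<omega>. emeasure (N \<omega>) (B \<inter> {- real m..real m}) \<partial>M) = ennreal c * emeasure lborel (B \<inter> {- real m..real m})"
    if "B \<in> sets borel" for m and B :: "real set"
  proof -
    let ?J = "{- real m..real m}"
    have sub: "range (\<lambda>(a, b). {a..b::real}) \<subseteq> Pow UNIV" by simp
    have "B \<in> sigma_sets UNIV (range (\<lambda>(a, b). {a..b}))"
      using that by (simp add: sets_borel_eq_atLeastAtMost)
    from Int_stable_atLeastAtMost sub this show ?thesis
    proof (induction rule: sigma_sets_induct_disjoint)
      case (basic B)
      then obtain a b where B: "B = {a..b}" by auto
      have BJ: "B \<inter> ?J = {max a (- real m)..min b (real m)}" using B by auto
      show ?case
      proof (cases "max a (- real m) \<le> min b (real m)")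
        case True
        then show ?thesis
          unfolding BJ using meas[OF True] int[OF True] c by (simp add: ennreal_mult)
      next
        case False
        then have "B \<inter> ?J = {}" unfolding BJ by simp
        then show ?thesis by simp
      qed
    next
      case empty
      show ?case by simp
    next
      case (compl B)
      then have B [measurable]: "B \<in> sets borel" by (simp add: sets_borel_eq_atLeastAtMost)
      have J: "(\<lambda>\<omega>. emeasure (N \<omega>) ?J) \<in> borel_measurable M"
        "(\<integral>\<^sup>+\<omega>. emeasure (N \<omega>) ?J \<partial>M) = ennreal c * emeasure lborel ?J"
        using meas[of "- real m" "real m"] int[of "- real m" "real m"] c by (simp_all add: ennreal_mult)
      have fin: "ennreal c * emeasure lborel ?J < \<infinity>"
        by (simp add: ennreal_mult_less_top)
      then have "AE \<omega> in M. emeasure (N \<omega>) ?J \<noteq> \<infinity>"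
        using J by (intro nn_integral_PInf_AE) auto
      \<comment> \<open>Masses can be subtracted where the mass of the window is finite, that is,
        almost everywhere; \<open>measurable_AE_eq\<close> then yields measurability.\<close>
      then have eq: "AE \<omega> in M. emeasure (N \<omega>) ?J - emeasure (N \<omega>) (B \<inter> ?J) = emeasure (N \<omega>) ((UNIV - B) \<inter> ?J)"
      proof eventually_elim
        case (elim \<omega>)
        have "emeasure (N \<omega>) (B \<inter> ?J) \<le> emeasure (N \<omega>) ?J"
          by (intro emeasure_mono) (auto simp: sets_N)
        then have "emeasure (N \<omega>) (?J - (B \<inter> ?J)) = emeasure (N \<omega>) ?J - emeasure (N \<omega>) (B \<inter> ?J)"
          using elim by (intro emeasure_Diff) (auto simp: sets_N top_unique)
        moreover have "?J - (B \<inter> ?J) = (UNIV - B) \<inter> ?J" by auto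
        ultimately show ?case by simp
      qed
      have le: "AE \<omega> in M. emeasure (N \<omega>) (B \<inter> ?J) \<le> emeasure (N \<omega>) ?J"
        by (intro AE_I2 emeasure_mono) (auto simp: sets_N)
      have "(\<integral>\<^sup>+\<omega>. emeasure (N \<omega>) (B \<inter> ?J) \<partial>M) \<le> (\<integral>\<^sup>+\<omega>. emeasure (N \<omega>) ?J \<partial>M)"
        using le by (rule nn_integral_mono_AE)
      then have finB: "(\<integral>\<^sup>+\<omega>. emeasure (N \<omega>) (B \<inter> ?J) \<partial>M) \<noteq> \<infinity>"
        using fin J by (auto simp: top_unique)
      have "(\<integral>\<^sup>+\<omega>. emeasure (N \<omega>) ((UNIV - B) \<inter> ?J) \<partial>M)
          = (\<integral>\<^sup>+\<omega>. emeasure (N \<omega>) ?J - emeasure (N \<omega>) (B \<inter> ?J) \<partial>M)"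
        using eq by (intro nn_integral_cong_AE) auto
      also have "\<dots> = (\<integral>\<^sup>+\<omega>. emeasure (N \<omega>) ?J \<partial>M) - (\<integral>\<^sup>+\<omega>. emeasure (N \<omega>) (B \<inter> ?J) \<partial>M)"
        using J(1) compl.IH finB le by (intro nn_integral_diff) auto
      also have "\<dots> = ennreal c * (emeasure lborel ?J - emeasure lborel (B \<inter> ?J))"
        using compl.IH by (simp add: J(2) ennreal_right_diff_distrib)
      also have "emeasure lborel ?J - emeasure lborel (B \<inter> ?J) = emeasure lborel (?J - (B \<inter> ?J))"
      proof (rule emeasure_Diff[symmetric])
        have "emeasure lborel (B \<inter> ?J) \<le> emeasure lborel ?J" by (intro emeasure_mono) auto
        then show "emeasure lborel (B \<inter> ?J) \<noteq> \<infinity>" by (auto simp: top_unique)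
      qed auto
      also have "?J - (B \<inter> ?J) = (UNIV - B) \<inter> ?J" by auto
      finally have "(\<integral>\<^sup>+\<omega>. emeasure (N \<omega>) ((UNIV - B) \<inter> ?J) \<partial>M) = ennreal c * emeasure lborel ((UNIV - B) \<inter> ?J)" .
      moreover have "(\<lambda>\<omega>. emeasure (N \<omega>) ?J - emeasure (N \<omega>) (B \<inter> ?J)) \<in> borel_measurable M"
        using J(1) compl.IH by (intro borel_measurable_minus_ennreal) auto
      from measurable_AE_eq[OF this eq] have "(\<lambda>\<omega>. emeasure (N \<omega>) ((UNIV - B) \<inter> ?J)) \<in> borel_measurable M"
        by simp
      ultimately show ?case by blast
    next
      case (union B)
      have B: "range B \<subseteq> sets borel" using union by (auto simp: sets_borel_eq_atLeastAtMost)
      have disj: "disjoint_family (\<lambda>i. B i \<inter> ?J)"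
        using union by (auto simp: disjoint_family_on_def)
      have BJ: "range (\<lambda>i. B i \<inter> ?J) \<subseteq> sets borel" using B by auto
      have UN: "(\<Union>i. B i \<inter> ?J) = \<Union> (range B) \<inter> ?J" by auto
      have N: "emeasure (N \<omega>) (\<Union> (range B) \<inter> ?J) = (\<Sum>i. emeasure (N \<omega>) (B i \<inter> ?J))" for \<omega>
        using suminf_emeasure[OF _ disj, of "N \<omega>"] BJ unfolding UN by (simp add: sets_N)
      have L: "emeasure lborel (\<Union> (range B) \<inter> ?J) = (\<Sum>i. emeasure lborel (B i \<inter> ?J))"
        using suminf_emeasure[OF _ disj, of lborel] BJ unfolding UN by simp
      have [measurable]: "(\<lambda>\<omega>. emeasure (N \<omega>) (B i \<inter> ?J)) \<in> borel_measurable M" for i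
        using union.IH by simp
      show ?case
        unfolding N L using union.IH by (auto simp: nn_integral_suminf)
    qed
  qed
  \<comment> \<open>The windows increase to the whole line; continuity from below and monotone
    convergence remove the restriction.\<close>
  have inc: "incseq (\<lambda>m. A \<inter> {- real m..real m})"
    by (auto simp: incseq_def)
  have UN: "(\<Union>m. A \<inter> {- real m..real m}) = A"
  proof safe
    fix x assume "x \<in> A"
    obtain m where "\<bar>x\<bar> \<le> real m" using real_arch_simple by blast
    with \<open>x \<in> A\<close> have "x \<in> A \<inter> {- real m..real m}" by auto
    then show "x \<in> (\<Union>m. A \<inter> {- real m..real m})" by blast
  qed
  have AJ: "range (\<lambda>m. A \<inter> {- real m..real m}) \<subseteq> sets borel" using A by auto
  have N: "emeasure (N \<omega>) A = (SUP m. emeasure (N \<omega>) (A \<inter> {- real m..real m}))" for \<omega>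
    using SUP_emeasure_incseq[OF _ inc, of "N \<omega>"] AJ unfolding UN by (simp add: sets_N)
  have L: "emeasure lborel A = (SUP m. emeasure lborel (A \<inter> {- real m..real m}))"
    using SUP_emeasure_incseq[OF _ inc, of lborel] AJ unfolding UN by simp
  show "(\<lambda>\<omega>. emeasure (N \<omega>) A) \<in> borel_measurable M"
    unfolding N using trunc[OF A] by (intro borel_measurable_SUP) auto
  have "(\<integral>\<^sup>+\<omega>. emeasure (N \<omega>) A \<partial>M) = (SUP m. \<integral>\<^sup>+\<omega>. emeasure (N \<omega>) (A \<inter> {- real m..real m}) \<partial>M)"
    unfolding N using trunc[OF A] A
    by (intro nn_integral_monotone_convergence_SUP)
      (auto simp: incseq_def le_fun_def sets_N intro!: emeasure_mono)
  also have "\<dots> = ennreal c * emeasure lborel A"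
    unfolding L using trunc[OF A] by (simp add: SUP_mult_left_ennreal)
  finally show "(\<integral>\<^sup>+\<omega>. emeasure (N \<omega>) A \<partial>M) = ennreal c * emeasure lborel A" .
qed

text \<open>Campbell's formula: simple functions follow from sets, and in the limit monotone
  convergence is applied to \<open>N \<omega>\<close>, to \<open>M\<close> and to Lebesgue
  measure.\<close>

lemma (in complete_measure) intensity_eq_lborel:
  fixes N :: "'a \<Rightarrow> real measure" and \<phi> :: "real \<Rightarrow> ennreal"
  assumes sets_N [measurable_cong]: "\<And>\<omega>. sets (N \<omega>) = sets borel" and c: "0 \<le> c"
    and meas: "\<And>a b. a \<le> b \<Longrightarrow> (\<lambda>\<omega>. emeasure (N \<omega>) {a..b}) \<in> borel_measurable M"
    and int: "\<And>a b. a \<le> b \<Longrightarrow> (\<integral>\<^sup>+\<omega>. emeasure (N \<omega>) {a..b} \<partial>M) = ennreal (c * (b - a))"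
    and \<phi>: "\<phi> \<in> borel_measurable borel"
  shows "(\<lambda>\<omega>. \<integral>\<^sup>+x. \<phi> x \<partial>N \<omega>) \<in> borel_measurable M"
    and "(\<integral>\<^sup>+\<omega>. (\<integral>\<^sup>+x. \<phi> x \<partial>N \<omega>) \<partial>M) = ennreal c * (\<integral>\<^sup>+x. \<phi> x \<partial>lborel)"
proof -
  note sets_eq = intensity_eq_lborel_sets[OF sets_N c meas int]
  have "(\<lambda>\<omega>. \<integral>\<^sup>+x. \<phi> x \<partial>N \<omega>) \<in> borel_measurable M \<and>
    (\<integral>\<^sup>+\<omega>. (\<integral>\<^sup>+x. \<phi> x \<partial>N \<omega>) \<partial>M) = ennreal c * (\<integral>\<^sup>+x. \<phi> x \<partial>lborel)"
    using \<phi>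
  proof (induction rule: borel_measurable_induct)
    case (cong f g)
    then show ?case by (simp cong: nn_integral_cong)
  next
    case (set A)
    then show ?case using sets_eq[of A] by (simp add: sets_N)
  next
    case (mult u k)
    have [measurable]: "(\<lambda>\<omega>. \<integral>\<^sup>+x. u x \<partial>N \<omega>) \<in> borel_measurable M" using mult by simp
    show ?case using mult by (simp add: nn_integral_cmult mult.left_commute)
  next
    case (add u v)
    have [measurable]: "(\<lambda>\<omega>. \<integral>\<^sup>+x. u x \<partial>N \<omega>) \<in> borel_measurable M" "(\<lambda>\<omega>. \<integral>\<^sup>+x. v x \<partial>N \<omega>) \<in> borel_measurable M"
      using add by simp_all
    show ?case using add by (simp add: nn_integral_add distrib_left)
  next
    case (seq U)
    have [measurable]: "U i \<in> borel_measurable borel" for i using seq by simp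
    have N: "(\<integral>\<^sup>+x. (SUP i. U i) x \<partial>N \<omega>) = (SUP i. \<integral>\<^sup>+x. U i x \<partial>N \<omega>)" for \<omega>
      using seq by (simp add: image_comp nn_integral_monotone_convergence_SUP)
    have L: "(\<integral>\<^sup>+x. (SUP i. U i) x \<partial>lborel) = (SUP i. \<integral>\<^sup>+x. U i x \<partial>lborel)"
      using seq by (simp add: image_comp nn_integral_monotone_convergence_SUP)
    have IH: "(\<lambda>\<omega>. \<integral>\<^sup>+x. U i x \<partial>N \<omega>) \<in> borel_measurable M"
      "(\<integral>\<^sup>+\<omega>. (\<integral>\<^sup>+x. U i x \<partial>N \<omega>) \<partial>M) = ennreal c * (\<integral>\<^sup>+x. U i x \<partial>lborel)" for i
      using seq by auto
    have "incseq (\<lambda>i \<omega>. \<integral>\<^sup>+x. U i x \<partial>N \<omega>)"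
      using seq(3) by (auto simp: incseq_def le_fun_def intro!: nn_integral_mono)
    then have "(\<integral>\<^sup>+\<omega>. (SUP i. \<integral>\<^sup>+x. U i x \<partial>N \<omega>) \<partial>M) = (SUP i. \<integral>\<^sup>+\<omega>. (\<integral>\<^sup>+x. U i x \<partial>N \<omega>) \<partial>M)"
      using IH by (intro nn_integral_monotone_convergence_SUP) auto
    then show ?case
      unfolding N L using IH by (auto simp: SUP_mult_left_ennreal)
  qed
  then show "(\<lambda>\<omega>. \<integral>\<^sup>+x. \<phi> x \<partial>N \<omega>) \<in> borel_measurable M"
    and "(\<integral>\<^sup>+\<omega>. (\<integral>\<^sup>+x. \<phi> x \<partial>N \<omega>) \<partial>M) = ennreal c * (\<integral>\<^sup>+x. \<phi> x \<partial>lborel)"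
    by auto
qed

section \<open>Radon measures are determined by continuous functions of compact support\<close>

text \<open>For \<open>a \<le> b\<close> the factor next to \<open>real n\<close> is the distance
  from \<open>x\<close> to \<open>{a..b}\<close>, so the function is 1 on the interval and falls
  linearly to 0 at distance \<open>1 / n\<close>. For \<open>n = 0\<close> it is constantly 1, which
  is why \<open>Suc n\<close> is used where compact support matters.\<close>

definition tent :: "real \<Rightarrow> real \<Rightarrow> nat \<Rightarrow> real \<Rightarrow> real" where
  "tent a b n x = max 0 (1 - real n * max 0 (max (a - x) (x - b)))"

lemma continuous_tent: "continuous_on A (tent a b n)"
  unfolding tent_def[abs_def] by (intro continuous_intros)

lemma tent_bounds: "0 \<le> tent a b n x" "tent a b n x \<le> 1"
  by (auto simp: tent_def)

lemma tent_support:
  assumes "n > 0" shows "{x. tent a b n x \<noteq> 0} \<subseteq> {a - 1..b + 1}"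
proof
  fix x assume "x \<in> {x. tent a b n x \<noteq> 0}"
  then have "real n * max 0 (max (a - x) (x - b)) < 1" by (auto simp: tent_def max_def split: if_splits)
  moreover have "1 * max 0 (max (a - x) (x - b)) \<le> real n * max 0 (max (a - x) (x - b))"
    using assms by (intro mult_right_mono) auto
  ultimately show "x \<in> {a - 1..b + 1}" by auto
qed

lemma tent_tendsto_indicator:
  "(\<lambda>n. tent a b n x) \<longlonglongrightarrow> indicator {a..b} x"
proof (cases "x \<in> {a..b}")
  case True
  then have "tent a b n x = 1" for n by (auto simp: tent_def max_def)
  with True show ?thesis by simp
next
  case False
  define t where "t = max 0 (max (a - x) (x - b))"
  have "t > 0" using False by (auto simp: t_def max_def)
  have "\<forall>\<^sub>F n in sequentially. 1 / t \<le> real n"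
    using filterlim_real_sequentially by (simp add: filterlim_at_top)
  then have "\<forall>\<^sub>F n in sequentially. tent a b n x = 0"
    by eventually_elim (use \<open>t > 0\<close> in \<open>auto simp: tent_def t_def[symmetric] field_simps\<close>)
  with False show ?thesis by (simp add: tendsto_eventually)
qed

text \<open>The mass of a compact interval is a limit of integrals of tents, dominated by the
  indicator of \<open>{a - 1..b + 1}\<close>, which is integrable since compact sets have finite
  mass. Compact intervals are stable under intersection, generate the Borel sets and exhaust the
  line.\<close>

lemma radon_measure_eqI:
  assumes \<mu>: "radon_measure \<mu>" and \<nu>: "radon_measure \<nu>"
    and eq: "\<And>\<phi> :: real \<Rightarrow> real. continuous_on UNIV \<phi> \<Longrightarrow> compact (closure {x. \<phi> x \<noteq> 0}) \<Longrightarrow>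
      (\<integral>x. \<phi> x \<partial>\<mu>) = (\<integral>x. \<phi> x \<partial>\<nu>)"
  shows "\<mu> = \<nu>"
proof -
  have lim: "(\<lambda>n. \<integral>x. tent a b (Suc n) x \<partial>\<rho>) \<longlonglongrightarrow> measure \<rho> {a..b}"
    if \<rho>: "radon_measure \<rho>" for \<rho> and a b :: real
  proof -
    have [measurable_cong]: "sets \<rho> = sets borel" using \<rho> by (simp add: radon_measure_def)
    have fin: "emeasure \<rho> {u..v} < \<infinity>" for u v using \<rho> by (simp add: radon_measure_def)
    have "(\<lambda>n. \<integral>x. tent a b (Suc n) x \<partial>\<rho>) \<longlonglongrightarrow> (\<integral>x. indicator {a..b} x \<partial>\<rho>)"
    proof (rule integral_dominated_convergence)
      show "integrable \<rho> (indicat_real {a - 1..b + 1})"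
        using fin by (simp add: integrable_indicator_iff)
      show "AE x in \<rho>. (\<lambda>n. tent a b (Suc n) x) \<longlonglongrightarrow> indicator {a..b} x"
        by (intro AE_I2 LIMSEQ_Suc tent_tendsto_indicator)
      show "AE x in \<rho>. norm (tent a b (Suc n) x) \<le> indicat_real {a - 1..b + 1} x" for n
      proof (rule AE_I2)
        fix x
        have "tent a b (Suc n) x = 0" if "x \<notin> {a - 1..b + 1}"
          using tent_support[of "Suc n" a b] that by auto
        then show "norm (tent a b (Suc n) x) \<le> indicat_real {a - 1..b + 1} x"
          using tent_bounds[of a b "Suc n" x] by (cases "x \<in> {a - 1..b + 1}") auto
      qed
      show "tent a b (Suc n) \<in> borel_measurable \<rho>" for n
        using borel_measurable_continuous_onI[OF continuous_tent] by simp
    qed auto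
    then show ?thesis by simp
  qed
  have meas: "measure \<mu> {a..b} = measure \<nu> {a..b}" for a b
  proof -
    have same: "(\<integral>x. tent a b (Suc n) x \<partial>\<mu>) = (\<integral>x. tent a b (Suc n) x \<partial>\<nu>)" for n
    proof (rule eq)
      have "bounded {x. tent a b (Suc n) x \<noteq> 0}"
        using tent_support[of "Suc n" a b] by (rule bounded_subset[rotated]) auto
      then show "compact (closure {x. tent a b (Suc n) x \<noteq> 0})" by simp
    qed (rule continuous_tent)
    show ?thesis
      using lim[OF \<mu>, of a b] lim[OF \<nu>, of a b] unfolding same by (rule LIMSEQ_unique)
  qed
  show ?thesis
  proof (rule measure_eqI_generator_eq[OF Int_stable_atLeastAtMost])
    show "sets \<mu> = sigma_sets UNIV (range (\<lambda>(a, b). {a..b}))" "sets \<nu> = sigma_sets UNIV (range (\<lambda>(a, b). {a..b}))"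
      using \<mu> \<nu> by (simp_all add: radon_measure_def sets_borel_eq_atLeastAtMost)
    have fin: "emeasure \<mu> {a..b} \<noteq> \<infinity>" "emeasure \<nu> {a..b} \<noteq> \<infinity>" for a b
      using \<mu> \<nu> by (auto simp: radon_measure_def less_top)
    then show "emeasure \<mu> X = emeasure \<nu> X" if "X \<in> range (\<lambda>(a, b). {a..b})" for X
      using that meas by (auto simp: emeasure_eq_ennreal_measure)
    show "range (\<lambda>n. {- real n..real n}) \<subseteq> range (\<lambda>(a, b). {a..b})" by auto
    show "(\<Union>n. {- real n..real n}) = UNIV"
    proof safe
      fix x :: real
      obtain m where "\<bar>x\<bar> \<le> real m" using real_arch_simple by blast
      then have "x \<in> {- real m..real m}" by auto
      then show "x \<in> (\<Union>n. {- real n..real n})" by blast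
    qed simp
    show "emeasure \<mu> {- real n..real n} \<noteq> \<infinity>" for n by (rule fin)
  qed simp
qed

section \<open>Zeros of the process\<close>

text \<open>Bulinskaya's lemma. Near a double zero \<open>f\<close> is \<open>o(1 / n)\<close> at the nearest point of a grid of
  mesh \<open>1 / n\<close>, whereas for each of the \<open>n\<close> grid points this has probability \<open>o(1 / n)\<close>.\<close>

lemma (in normalized_gaussian_process) AE_no_double_zero:
  "AE \<omega> in M. \<forall>x. f x \<omega> = 0 \<longrightarrow> \<not> ((\<lambda>x. f x \<omega>) has_real_derivative 0) (at x)"
proof -
  \<comment> \<open>Some grid point of the unit cell at \<open>c\<close> has a value of size at most
    \<open>1 / (j + 1)\<close> times the mesh \<open>1 / (n + 1)\<close>. The outcomes with a double
    zero need not form a measurable set; they are enclosed in events built from these.\<close>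
  define small where "small c j n = {\<omega> \<in> space M. \<exists>k\<in>{..n}. \<bar>f (real_of_int c + real k / real (Suc n)) \<omega>\<bar> \<le> 1 / real (Suc j) / real (Suc n)}"
    for c :: int and j n :: nat
  have [measurable]: "small c j n \<in> sets M" for c j n
    unfolding small_def by measurable
  have prob_small: "prob (small c j n) \<le> 2 / real (Suc j)" for c j n
  proof -
    let ?e = "1 / real (Suc j) / real (Suc n)"
    let ?B = "\<lambda>k. {\<omega> \<in> space M. \<bar>f (real_of_int c + real k / real (Suc n)) \<omega>\<bar> \<le> ?e}"
    have "small c j n = (\<Union>k\<in>{..n}. ?B k)" by (auto simp: small_def)
    then have "prob (small c j n) \<le> (\<Sum>k\<le>n. prob (?B k))"
      by (simp add: finite_measure_subadditive_finite image_subset_iff)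
    \<comment> \<open>The \<open>n + 1\<close> points cancel the factor \<open>1 / (n + 1)\<close>
      in the level, so the bound is uniform in \<open>n\<close>.\<close>
    also have "\<dots> \<le> (\<Sum>k\<le>n. 2 * ?e)" by (intro sum_mono prob_abs_le) simp
    also have "\<dots> = 2 / real (Suc j)" by (simp del: of_nat_Suc add: of_nat_Suc[symmetric])
    finally show ?thesis .
  qed
  \<comment> \<open>The limit inferior of the events over the mesh. It is an increasing union of
    events that satisfy the uniform bound, so it satisfies this bound as well, and intersecting over
    \<open>j\<close> leaves a null set.\<close>
  define persist where "persist c j = (\<Union>n. \<Inter>m\<in>{n..}. small c j m)" for c j
  have [measurable]: "persist c j \<in> sets M" for c j
    unfolding persist_def by measurable
  have prob_persist: "prob (persist c j) \<le> 2 / real (Suc j)" for c j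
  proof (rule LIMSEQ_le_const2)
    show "(\<lambda>n. prob (\<Inter>m\<in>{n..}. small c j m)) \<longlonglongrightarrow> prob (persist c j)"
      unfolding persist_def
      by (intro finite_Lim_measure_incseq) (auto simp: incseq_def image_subset_iff)
    have "prob (\<Inter>m\<in>{n..}. small c j m) \<le> prob (small c j n)" for n
      by (intro finite_measure_mono) auto
    then show "\<exists>N. \<forall>n\<ge>N. prob (\<Inter>m\<in>{n..}. small c j m) \<le> 2 / real (Suc j)"
      using prob_small order_trans by blast
  qed
  have "AE \<omega> in M. \<omega> \<notin> (\<Inter>j. persist c j)" for c
  proof (rule AE_not_in)
    have "prob (\<Inter>j. persist c j) \<le> 0"
    proof (rule LIMSEQ_le_const)
      show "(\<lambda>j. 2 / real (Suc j)) \<longlonglongrightarrow> 0"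
        by (intro LIMSEQ_Suc lim_const_over_n)
      have "prob (\<Inter>j. persist c j) \<le> prob (persist c j)" for j
        by (intro finite_measure_mono) auto
      then show "\<exists>N. \<forall>j\<ge>N. prob (\<Inter>j. persist c j) \<le> 2 / real (Suc j)"
        using prob_persist order_trans by blast
    qed
    then show "(\<Inter>j. persist c j) \<in> null_sets M"
      by (simp add: null_sets_def emeasure_eq_measure measure_le_0_iff)
  qed
  then have "AE \<omega> in M. \<forall>c. \<omega> \<notin> (\<Inter>j. persist c j)"
    by (simp add: AE_all_countable)
  with AE_space show ?thesis
  proof eventually_elim
    case (elim \<omega>)
    show ?case
    proof safe
      fix x assume 0: "f x \<omega> = 0" and D: "((\<lambda>x. f x \<omega>) has_real_derivative 0) (at x)"
      define c where "c = \<lfloor>x\<rfloor>"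
      have "\<omega> \<in> persist c j" for j
      proof -
        \<comment> \<open>With value and derivative both zero, \<open>f\<close> is bounded near
          \<open>x\<close> by an arbitrarily small slope; the slope taken is the factor
          \<open>1 / (j + 1)\<close> in \<open>small\<close>.\<close>
        have "\<forall>e>0. \<exists>d>0. \<forall>y. \<bar>y - x\<bar> < d \<longrightarrow> \<bar>f y \<omega>\<bar> \<le> e * \<bar>y - x\<bar>"
          using D 0 unfolding has_field_derivative_def has_derivative_at_alt by simp
        from this[rule_format, of "1 / real (Suc j)"]
        obtain d where d: "d > 0" "\<And>y. \<bar>y - x\<bar> < d \<Longrightarrow> \<bar>f y \<omega>\<bar> \<le> 1 / real (Suc j) * \<bar>y - x\<bar>"
          by auto
        obtain n where n: "1 / real (Suc n) < d"
          using nat_approx_posE[OF d(1)] by blast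
        have "\<omega> \<in> small c j m" if "m \<ge> n" for m
        proof -
          define t where "t = (x - real_of_int c) * real (Suc m)"
          \<comment> \<open>The grid point at \<open>x\<close> or next to its left;
            \<open>x < c + 1\<close> keeps its index at most \<open>m\<close>.\<close>
          define k where "k = nat \<lfloor>t\<rfloor>"
          have "0 \<le> x - real_of_int c" "x - real_of_int c < 1" by (auto simp: c_def) linarith
          then have t: "0 \<le> t" "t < real (Suc m)" "x = real_of_int c + t / real (Suc m)"
            by (simp_all add: t_def del: of_nat_Suc)
          then have k: "real k \<le> t" "t < real k + 1"
            by (simp_all add: k_def)
          then have "k \<le> m" using t by simp
          have "real_of_int c + real k / real (Suc m) - x = (real k - t) / real (Suc m)"
            by (simp add: t(3) diff_divide_distrib)
          moreover have "\<bar>real k - t\<bar> \<le> 1" using k by simp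
          ultimately have near: "\<bar>real_of_int c + real k / real (Suc m) - x\<bar> \<le> 1 / real (Suc m)"
            by (simp add: abs_divide divide_right_mono del: of_nat_Suc)
          also have "\<dots> \<le> 1 / real (Suc n)" using that by (intro divide_left_mono) auto
          also note n
          finally have "\<bar>f (real_of_int c + real k / real (Suc m)) \<omega>\<bar>
              \<le> 1 / real (Suc j) * \<bar>real_of_int c + real k / real (Suc m) - x\<bar>"
            by (rule d(2))
          also have "\<dots> \<le> 1 / real (Suc j) * (1 / real (Suc m))"
            using near by (intro mult_left_mono) auto
          finally show ?thesis
            using \<open>k \<le> m\<close> elim by (auto simp: small_def simp del: of_nat_Suc)
        qed
        then show ?thesis by (auto simp: persist_def)
      qed
      then show False using elim by blast
    qed
  qed
qed

section \<open>Mean number of zeros and mean integrals against the zero measure\<close>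

lemma emeasure_zero_measure:
  assumes "A \<in> sets borel"
  shows "emeasure (zero_measure f R \<omega>) A = emeasure (count_space UNIV) {x \<in> A. f (R * x) \<omega> = 0}"
proof -
  have "emeasure (zero_measure f R \<omega>) A
      = emeasure (count_space {x. f (R * x) \<omega> = 0}) {x \<in> A. f (R * x) \<omega> = 0}"
    unfolding zero_measure_def using assms
    by (subst emeasure_distr) (auto intro!: arg_cong2[where f = emeasure])
  moreover have "{x \<in> A. f (R * x) \<omega> = 0} \<subseteq> {x. f (R * x) \<omega> = 0}" by auto
  ultimately show ?thesis
    by (simp only: emeasure_count_space subset_UNIV)
qed

locale C1_normalized_gaussian_process = normalized_gaussian_process +
  fixes R :: real
  assumes C1: "C1_process M f" and R: "R > 0"
begin

lemma AE_simple_zeros: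
  "AE \<omega> in M. continuous_on UNIV (\<lambda>x. f (R * x) \<omega>) \<and>
    (\<forall>z. f (R * z) \<omega> = 0 \<longrightarrow> (\<exists>D. D \<noteq> 0 \<and> ((\<lambda>x. f (R * x) \<omega>) has_real_derivative D) (at z)))"
proof -
  have "AE \<omega> in M. (\<lambda>x. f x \<omega>) C1_differentiable_on UNIV"
    using C1 by (simp add: C1_process_def)
  with AE_no_double_zero show ?thesis
  proof eventually_elim
    case (elim \<omega>)
    have "\<exists>D. ((\<lambda>x. f x \<omega>) has_real_derivative D) (at x)" for x
      using elim(2) unfolding C1_differentiable_on_def has_real_derivative_iff_has_vector_derivative by blast
    then obtain D where D: "((\<lambda>x. f x \<omega>) has_real_derivative D x) (at x)" for x by metis
    have DR: "((\<lambda>x. f (R * x) \<omega>) has_real_derivative D (R * x) * R) (at x)" for x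
      by (rule DERIV_chain'[OF _ D]) (auto intro!: derivative_eq_intros)
    have "continuous_on UNIV (\<lambda>x. f (R * x) \<omega>)"
      using DR by (intro DERIV_continuous_on) (auto intro: has_field_derivative_at_within)
    moreover have "D (R * z) * R \<noteq> 0" if "f (R * z) \<omega> = 0" for z
      using elim(1) D[of "R * z"] that R by auto
    ultimately show ?case using DR by blast
  qed
qed

text \<open>Linearity gives a sum of \<open>n\<close> probabilities, equal by stationarity. In the
  time scale of \<open>f\<close> their common lag is \<open>L / n\<close> with
  \<open>L = R * (b - a)\<close>, so each of them is asymptotic to
  \<open>L / (n * pi)\<close>.\<close>

lemma tendsto_expectation_card_sign_changes:
  assumes ab: "a < b"
  shows "(\<lambda>n. \<integral>\<^sup>+\<omega>. of_nat (card (sign_changes (\<lambda>x. f (R * x) \<omega>) a b n)) \<partial>M)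
    \<longlonglongrightarrow> ennreal (R / pi * (b - a))"
proof -
  let ?p = "\<lambda>h. prob {\<omega> \<in> space M. f 0 \<omega> * f h \<omega> < 0}"
  define L where "L = R * (b - a)"
  have L: "L > 0" using R ab by (simp add: L_def)
  have eq: "(\<integral>\<^sup>+\<omega>. of_nat (card (sign_changes (\<lambda>x. f (R * x) \<omega>) a b n)) \<partial>M) = ennreal (real n * ?p (L / real n))" for n
  proof -
    let ?S = "\<lambda>k. {\<omega> \<in> space M. f (R * grid a b n k) \<omega> * f (R * grid a b n (Suc k)) \<omega> < 0}"
    have "(\<integral>\<^sup>+\<omega>. of_nat (card (sign_changes (\<lambda>x. f (R * x) \<omega>) a b n)) \<partial>M)
        = (\<integral>\<^sup>+\<omega>. (\<Sum>k<n. indicator (?S k) \<omega>) \<partial>M)"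
    proof (rule nn_integral_cong)
      fix \<omega> assume "\<omega> \<in> space M"
      then have "sign_changes (\<lambda>x. f (R * x) \<omega>) a b n = {..<n} \<inter> {k. \<omega> \<in> ?S k}"
        by (auto simp: sign_changes_def)
      then show "of_nat (card (sign_changes (\<lambda>x. f (R * x) \<omega>) a b n)) = (\<Sum>k<n. indicator (?S k) \<omega> :: ennreal)"
        by (simp add: indicator_def sum.If_cases of_bool_def)
    qed
    also have "\<dots> = (\<Sum>k<n. ennreal (prob (?S k)))"
      by (simp add: nn_integral_sum emeasure_eq_measure)
    also have "\<dots> = (\<Sum>k<n. ennreal (?p (L / real n)))"
    proof (rule sum.cong)
      fix k
      have "R * grid a b n (Suc k) = R * grid a b n k + L / real n"
        by (simp add: grid_Suc L_def distrib_left)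
      then show "ennreal (prob (?S k)) = ennreal (?p (L / real n))"
        by (simp add: prob_sign_change_shift)
    qed simp
    also have "\<dots> = ennreal (real n * ?p (L / real n))"
      by (simp add: ennreal_mult ennreal_of_nat_eq_real_of_nat)
    finally show ?thesis .
  qed
  have "(\<lambda>n. L / real n) \<longlonglongrightarrow> 0" by (rule lim_const_over_n)
  moreover have "\<forall>\<^sub>F n in sequentially. 0 < L / real n"
    using eventually_gt_at_top[of "0::nat"] by eventually_elim (use L in simp)
  ultimately have "filterlim (\<lambda>n. L / real n) (at_right 0) sequentially"
    by (rule tendsto_imp_filterlim_at_right)
  from filterlim_compose[OF prob_sign_change_asymp this]
  have "(\<lambda>n. L * (?p (L / real n) / (L / real n))) \<longlonglongrightarrow> L * (1 / pi)"
    by (intro tendsto_mult_left)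
  \<comment> \<open>For \<open>n = 0\<close> both sides are 0, since division by zero yields
    0.\<close>
  moreover have "L * (?p (L / real n) / (L / real n)) = real n * ?p (L / real n)" for n
    using L by simp
  ultimately have "(\<lambda>n. real n * ?p (L / real n)) \<longlonglongrightarrow> R / pi * (b - a)"
    by (simp add: L_def)
  then show ?thesis unfolding eq by (rule tendsto_ennrealI)
qed

lemma zero_measure_interval:
  assumes "a \<le> b"
  shows "(\<lambda>\<omega>. emeasure (zero_measure f R \<omega>) {a..b}) \<in> borel_measurable (completion M)"
    and "(\<integral>\<^sup>+\<omega>. emeasure (zero_measure f R \<omega>) {a..b} \<partial>completion M) = ennreal (R / pi * (b - a))"
proof -
  let ?E = "\<lambda>\<omega>. emeasure (zero_measure f R \<omega>) {a..b}"
  \<comment> \<open>The integral is first taken over \<open>M\<close>: as a supremum over simple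
    functions it is defined without measurability and does not change under completion.\<close>
  have "?E \<in> borel_measurable (completion M) \<and> (\<integral>\<^sup>+\<omega>. ?E \<omega> \<partial>M) = ennreal (R / pi * (b - a))"
  proof (cases "a = b")
    case True
    \<comment> \<open>A degenerate interval has no cells of positive length, but its only point is
      almost surely not a zero.\<close>
    have ae: "AE \<omega> in M. 0 = ?E \<omega>"
      using AE_nonzero[of "R * a"]
    proof eventually_elim
      case (elim \<omega>)
      then have "{x \<in> {a..b}. f (R * x) \<omega> = 0} = {}" using True by auto
      then show ?case
        unfolding emeasure_zero_measure[OF atLeastAtMost_borel] by (simp only: emeasure_empty)
    qed
    have "(\<integral>\<^sup>+\<omega>. ?E \<omega> \<partial>M) = (\<integral>\<^sup>+\<omega>. 0 \<partial>M)"
      using ae by (intro nn_integral_cong_AE) auto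
    moreover have "?E \<in> borel_measurable (completion M)"
      by (rule completion.measurable_AE_eq[OF _ AE_completion[OF ae]]) auto
    ultimately show ?thesis using True by simp
  next
    case False
    then have ab: "a < b" using assms by simp
    let ?N = "\<lambda>n \<omega>. of_nat (card (sign_changes (\<lambda>x. f (R * x) \<omega>) a b n)) :: ennreal"
    have [measurable]: "?N n \<in> borel_measurable M" for n
    proof -
      have "?N n \<omega> = (\<Sum>k<n. if f (R * grid a b n k) \<omega> * f (R * grid a b n (Suc k)) \<omega> < 0 then 1 else 0)" for \<omega>
        by (simp add: sign_changes_def sum.If_cases Collect_conj_eq lessThan_def)
      then show ?thesis by simp
    qed
    have "AE \<omega> in M. \<forall>n k. f (R * grid a b n k) \<omega> \<noteq> 0"
      by (simp add: AE_all_countable AE_nonzero)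
    \<comment> \<open>The limit inferior is a measurable function of every outcome, while the limit
      itself is under control almost surely; it is also the form that Fatou's lemma
      requires.\<close>
    with AE_simple_zeros have ae: "AE \<omega> in M. (\<forall>n. ?N n \<omega> \<le> ?E \<omega>) \<and> liminf (\<lambda>n. ?N n \<omega>) = ?E \<omega>"
    proof eventually_elim
      case (elim \<omega>)
      let ?F = "\<lambda>x. f (R * x) \<omega>"
      have fin: "finite {x \<in> {a..b}. ?F x = 0}"
        using elim by (intro finite_simple_zeros) auto
      then have E: "?E \<omega> = of_nat (card {x \<in> {a..b}. ?F x = 0})"
        by (simp add: emeasure_zero_measure emeasure_count_space_finite)
      have "\<forall>\<^sub>F n in sequentially. card (sign_changes ?F a b n) = card {x \<in> {a..b}. ?F x = 0}"
        using elim ab by (intro eventually_card_sign_changes) auto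
      then have "\<forall>\<^sub>F n in sequentially. ?N n \<omega> = ?E \<omega>"
        by eventually_elim (simp add: E)
      then have "(\<lambda>n. ?N n \<omega>) \<longlonglongrightarrow> ?E \<omega>" by (rule tendsto_eventually)
      moreover have "?N n \<omega> \<le> ?E \<omega>" for n
        using card_sign_changes_le[OF _ fin ab] elim unfolding E by (intro of_nat_mono) auto
      ultimately show ?case
        by (auto intro!: lim_imp_Liminf)
    qed
    then have aeq: "AE \<omega> in M. liminf (\<lambda>n. ?N n \<omega>) = ?E \<omega>" by auto
    have "?E \<in> borel_measurable (completion M)"
      by (rule completion.measurable_AE_eq[OF _ AE_completion[OF aeq]]) (auto intro!: measurable_completion)
    moreover have "(\<integral>\<^sup>+\<omega>. ?E \<omega> \<partial>M) = ennreal (R / pi * (b - a))"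
    proof (rule antisym)
      note lim = tendsto_expectation_card_sign_changes[OF ab]
      have "(\<integral>\<^sup>+\<omega>. ?E \<omega> \<partial>M) = (\<integral>\<^sup>+\<omega>. liminf (\<lambda>n. ?N n \<omega>) \<partial>M)"
        using aeq by (intro nn_integral_cong_AE) auto
      also have "\<dots> \<le> liminf (\<lambda>n. \<integral>\<^sup>+\<omega>. ?N n \<omega> \<partial>M)"
        by (rule nn_integral_liminf) simp
      also have "\<dots> = ennreal (R / pi * (b - a))"
        using lim by (intro lim_imp_Liminf) auto
      finally show "(\<integral>\<^sup>+\<omega>. ?E \<omega> \<partial>M) \<le> ennreal (R / pi * (b - a))" .
      have "(\<integral>\<^sup>+\<omega>. ?N n \<omega> \<partial>M) \<le> (\<integral>\<^sup>+\<omega>. ?E \<omega> \<partial>M)" for n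
        using ae by (intro nn_integral_mono_AE) auto
      with lim show "ennreal (R / pi * (b - a)) \<le> (\<integral>\<^sup>+\<omega>. ?E \<omega> \<partial>M)"
        by (intro LIMSEQ_le_const2[OF lim]) auto
    qed
    ultimately show ?thesis by blast
  qed
  then show "?E \<in> borel_measurable (completion M)"
    and "(\<integral>\<^sup>+\<omega>. ?E \<omega> \<partial>completion M) = ennreal (R / pi * (b - a))"
    by (simp_all add: nn_integral_completion)
qed

lemma nn_integral_zero_measure_mean:
  fixes \<phi> :: "real \<Rightarrow> ennreal"
  assumes "\<phi> \<in> borel_measurable borel"
  shows "(\<lambda>\<omega>. \<integral>\<^sup>+x. \<phi> x \<partial>zero_measure f R \<omega>) \<in> borel_measurable (completion M)"
    and "(\<integral>\<^sup>+\<omega>. (\<integral>\<^sup>+x. \<phi> x \<partial>zero_measure f R \<omega>) \<partial>completion M) = ennreal (R / pi) * (\<integral>\<^sup>+x. \<phi> x \<partial>lborel)"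
  using assms R zero_measure_interval
  by (auto intro!: completion.intensity_eq_lborel[where c = "R / pi"] simp: zero_measure_def)

text \<open>A finite mean for the absolute value makes \<open>\<phi>\<close> integrable against
  almost every zero measure. For the other outcomes the integral defaults to 0 and may differ from
  the difference of the two parts, so this decomposition holds almost surely only.\<close>

lemma integral_zero_measure_mean:
  fixes \<phi> :: "real \<Rightarrow> real"
  assumes \<phi>: "integrable lborel \<phi>"
  shows "AE \<omega> in M. integrable (zero_measure f R \<omega>) \<phi>"
    and "integrable (completion M) (\<lambda>\<omega>. \<integral>x. \<phi> x \<partial>zero_measure f R \<omega>)"
    and "(\<integral>\<omega>. (\<integral>x. \<phi> x \<partial>zero_measure f R \<omega>) \<partial>completion M) = R / pi * (\<integral>x. \<phi> x \<partial>lborel)"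
proof -
  let ?Z = "zero_measure f R"
  have [measurable]: "\<phi> \<in> borel_measurable borel" using \<phi> by simp
  have [measurable_cong]: "sets (?Z \<omega>) = sets borel" for \<omega> by (simp add: zero_measure_def)
  have part: "(\<lambda>\<omega>. \<integral>\<^sup>+x. ennreal (g x) \<partial>?Z \<omega>) \<in> borel_measurable (completion M)"
    "(\<integral>\<^sup>+\<omega>. (\<integral>\<^sup>+x. ennreal (g x) \<partial>?Z \<omega>) \<partial>completion M) = ennreal (R / pi * (\<integral>x. g x \<partial>lborel))"
    "AE \<omega> in M. (\<integral>\<^sup>+x. ennreal (g x) \<partial>?Z \<omega>) < \<infinity>"
    if g: "integrable lborel g" "\<And>x. 0 \<le> g x" for g
  proof -
    have [measurable]: "g \<in> borel_measurable borel" using g by simp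
    show m: "(\<lambda>\<omega>. \<integral>\<^sup>+x. ennreal (g x) \<partial>?Z \<omega>) \<in> borel_measurable (completion M)"
      by (rule nn_integral_zero_measure_mean) simp
    show i: "(\<integral>\<^sup>+\<omega>. (\<integral>\<^sup>+x. ennreal (g x) \<partial>?Z \<omega>) \<partial>completion M) = ennreal (R / pi * (\<integral>x. g x \<partial>lborel))"
      using g R nn_integral_zero_measure_mean(2)[of g] ennreal_mult[of "R / pi" "\<integral>x. g x \<partial>lborel"]
      by (simp add: nn_integral_eq_integral)
    have "AE \<omega> in completion M. (\<integral>\<^sup>+x. ennreal (g x) \<partial>?Z \<omega>) \<noteq> \<infinity>"
      using m by (rule nn_integral_PInf_AE) (simp add: i)
    then show "AE \<omega> in M. (\<integral>\<^sup>+x. ennreal (g x) \<partial>?Z \<omega>) < \<infinity>"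
      by (simp add: AE_completion_iff less_top)
  qed
  have mean: "integrable (completion M) (\<lambda>\<omega>. enn2real (\<integral>\<^sup>+x. ennreal (g x) \<partial>?Z \<omega>)) \<and>
    (\<integral>\<omega>. enn2real (\<integral>\<^sup>+x. ennreal (g x) \<partial>?Z \<omega>) \<partial>completion M) = R / pi * (\<integral>x. g x \<partial>lborel)"
    if g: "integrable lborel g" "\<And>x. 0 \<le> g x" for g
  proof -
    have "(\<integral>\<^sup>+\<omega>. ennreal (enn2real (\<integral>\<^sup>+x. ennreal (g x) \<partial>?Z \<omega>)) \<partial>completion M)
        = (\<integral>\<^sup>+\<omega>. (\<integral>\<^sup>+x. ennreal (g x) \<partial>?Z \<omega>) \<partial>completion M)"
      using AE_completion[OF part(3)[OF g]] by (intro nn_integral_cong_AE) auto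
    then have "(\<integral>\<^sup>+\<omega>. ennreal (enn2real (\<integral>\<^sup>+x. ennreal (g x) \<partial>?Z \<omega>)) \<partial>completion M) = ennreal (R / pi * (\<integral>x. g x \<partial>lborel))"
      by (simp add: part(2)[OF g])
    moreover have "0 \<le> R / pi * (\<integral>x. g x \<partial>lborel)" using g R by simp
    ultimately have "has_bochner_integral (completion M) (\<lambda>\<omega>. enn2real (\<integral>\<^sup>+x. ennreal (g x) \<partial>?Z \<omega>)) (R / pi * (\<integral>x. g x \<partial>lborel))"
      using part(1)[OF g] by (intro has_bochner_integral_nn_integral) auto
    then show ?thesis by (simp add: has_bochner_integral_iff)
  qed
  let ?p = "\<lambda>x. max 0 (\<phi> x)" and ?m = "\<lambda>x. max 0 (- \<phi> x)"
  have pm: "integrable lborel ?p" "integrable lborel ?m" "integrable lborel (\<lambda>x. \<bar>\<phi> x\<bar>)" using \<phi> by auto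
  show ae: "AE \<omega> in M. integrable (?Z \<omega>) \<phi>"
    using part(3)[OF pm(3)] by (auto simp: integrable_iff_bounded)
  have eq: "AE \<omega> in completion M. enn2real (\<integral>\<^sup>+x. ennreal (?p x) \<partial>?Z \<omega>) - enn2real (\<integral>\<^sup>+x. ennreal (?m x) \<partial>?Z \<omega>)
      = (\<integral>x. \<phi> x \<partial>?Z \<omega>)"
    using AE_completion[OF ae] by eventually_elim (simp add: real_lebesgue_integral_def)
  have meas: "(\<lambda>\<omega>. \<integral>x. \<phi> x \<partial>?Z \<omega>) \<in> borel_measurable (completion M)"
  proof (rule completion.measurable_AE_eq[OF _ eq])
    show "(\<lambda>\<omega>. enn2real (\<integral>\<^sup>+x. ennreal (?p x) \<partial>?Z \<omega>) - enn2real (\<integral>\<^sup>+x. ennreal (?m x) \<partial>?Z \<omega>))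
        \<in> borel_measurable (completion M)"
      using mean[of ?p] mean[of ?m] pm by (intro borel_measurable_diff borel_measurable_integrable) auto
  qed simp
  show "integrable (completion M) (\<lambda>\<omega>. \<integral>x. \<phi> x \<partial>?Z \<omega>)"
    by (rule integrable_cong_AE_imp[OF _ meas eq]) (use mean[of ?p] mean[of ?m] pm in auto)
  have "(\<integral>\<omega>. (\<integral>x. \<phi> x \<partial>?Z \<omega>) \<partial>completion M)
      = (\<integral>\<omega>. enn2real (\<integral>\<^sup>+x. ennreal (?p x) \<partial>?Z \<omega>) - enn2real (\<integral>\<^sup>+x. ennreal (?m x) \<partial>?Z \<omega>) \<partial>completion M)"
    using eq meas part(1)[of ?p] part(1)[of ?m] pm by (intro integral_cong_AE) auto
  also have "\<dots> = R / pi * ((\<integral>x. ?p x \<partial>lborel) - (\<integral>x. ?m x \<partial>lborel))"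
    using mean[of ?p] mean[of ?m] pm by (simp add: right_diff_distrib)
  also have "(\<integral>x. ?p x \<partial>lborel) - (\<integral>x. ?m x \<partial>lborel) = (\<integral>x. ?p x - ?m x \<partial>lborel)"
    using pm by simp
  also have "(\<lambda>x. ?p x - ?m x) = \<phi>" by (auto simp: max_def)
  finally show "(\<integral>\<omega>. (\<integral>x. \<phi> x \<partial>?Z \<omega>) \<partial>completion M) = R / pi * (\<integral>x. \<phi> x \<partial>lborel)" .
qed

lemma is_mean_measure_zero_measure:
  "is_mean_measure M (zero_measure f R) (density lborel (\<lambda>x. ennreal (R / pi)))"
  unfolding is_mean_measure_def
proof (intro conjI allI impI)
  show "radon_measure (density lborel (\<lambda>x. ennreal (R / pi)))"
    unfolding radon_measure_def
    using emeasure_compact_finite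
    by (auto simp: emeasure_density nn_integral_cmult ennreal_mult_less_top compact_imp_closed)
next
  fix \<phi> :: "real \<Rightarrow> real"
  assume "continuous_on UNIV \<phi> \<and> compact (closure {x. \<phi> x \<noteq> 0})"
  then have cont: "continuous_on UNIV \<phi>" and comp: "compact (closure {x. \<phi> x \<noteq> 0})" by auto
  let ?S = "closure {x. \<phi> x \<noteq> 0}"
  have "integrable lborel (\<lambda>x. indicator ?S x *\<^sub>R \<phi> x)"
    using comp continuous_on_subset[OF cont] by (intro borel_integrable_compact) auto
  also have "(\<lambda>x. indicator ?S x *\<^sub>R \<phi> x) = \<phi>"
    using closure_subset[of "{x. \<phi> x \<noteq> 0}"] by (auto simp: indicator_def fun_eq_iff)
  finally have int: "integrable lborel \<phi>" .
  show "AE \<omega> in M. integrable (zero_measure f R \<omega>) \<phi>"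
    "integrable (completion M) (\<lambda>\<omega>. \<integral>x. \<phi> x \<partial>zero_measure f R \<omega>)"
    by (rule integral_zero_measure_mean[OF int])+
  show "(\<integral>x. \<phi> x \<partial>density lborel (\<lambda>x. ennreal (R / pi))) = (\<integral>\<omega>. (\<integral>x. \<phi> x \<partial>zero_measure f R \<omega>) \<partial>completion M)"
    using R int unfolding integral_zero_measure_mean(3)[OF int]
    by (subst integral_density) auto
qed

text \<open>Any two candidates have the same test integrals, namely the expectations, so
  \<open>radon_measure_eqI\<close> identifies them.\<close>

lemma mean_measure_zero_measure:
  "mean_measure M (zero_measure f R) = density lborel (\<lambda>x. ennreal (R / pi))"
  unfolding mean_measure_def
proof (rule the_equality)
  show "is_mean_measure M (zero_measure f R) (density lborel (\<lambda>x. ennreal (R / pi)))"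
    by (rule is_mean_measure_zero_measure)
next
  fix \<mu> assume "is_mean_measure M (zero_measure f R) \<mu>"
  with is_mean_measure_zero_measure show "\<mu> = density lborel (\<lambda>x. ennreal (R / pi))"
    unfolding is_mean_measure_def by (intro radon_measure_eqI) auto
qed

end

theorem proposition1p8:
  fixes M :: "'a measure" and f :: "real \<Rightarrow> 'a \<Rightarrow> real" and R :: real
  assumes "prob_space M"
    and "gaussian_process M f"
    and "centered_process M f"
    and "stationary_process M f"
    and "C1_process M f"
    and "normalized_process M f"
    and "R > 0"
  shows
    "(\<forall>\<phi> :: real \<Rightarrow> real. \<phi> \<in> borel_measurable borel \<and> (\<forall>x. 0 \<le> \<phi> x) \<longrightarrow>
        (\<lambda>\<omega>. \<integral>\<^sup>+x. ennreal (\<phi> x) \<partial>zero_measure f R \<omega>) \<in> borel_measurable (completion M) \<and>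
        (\<integral>\<^sup>+\<omega>. (\<integral>\<^sup>+x. ennreal (\<phi> x) \<partial>zero_measure f R \<omega>) \<partial>completion M) =
          ennreal (R / pi) * (\<integral>\<^sup>+x. ennreal (\<phi> x) \<partial>lborel)) \<and>
     (\<forall>\<phi> :: real \<Rightarrow> real. \<phi> \<in> borel_measurable borel \<and> integrable lborel \<phi> \<longrightarrow>
        (AE \<omega> in M. integrable (zero_measure f R \<omega>) \<phi>) \<and>
        integrable (completion M) (\<lambda>\<omega>. \<integral>x. \<phi> x \<partial>zero_measure f R \<omega>) \<and>
        (\<integral>\<omega>. (\<integral>x. \<phi> x \<partial>zero_measure f R \<omega>) \<partial>completion M) = R / pi * (\<integral>x. \<phi> x \<partial>lborel)) \<and>
     is_mean_measure M (zero_measure f R) (density lborel (\<lambda>x. ennreal (R / pi))) \<and>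
     mean_measure M (zero_measure f R) = density lborel (\<lambda>x. ennreal (R / pi))"
proof -
  interpret prob_space M by fact
  interpret C1_normalized_gaussian_process M f R
    by unfold_locales fact+
  show ?thesis
    using nn_integral_zero_measure_mean integral_zero_measure_mean
      is_mean_measure_zero_measure mean_measure_zero_measure
    by simp
qed

end
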